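(* Let $d\ge 3$ and $E\in(-2d,2d)$. Let $\nu$ be a probability measure on $\mathbb{R}$ with $\int |x|\,d\nu(x)<\infty$, let $\{q^\omega(n)\}_{n\in\mathbb{Z}^d}$ be independent real random variables each distributed according to $\nu$, and let $\{a_n\}_{n\in\mathbb{Z}^d}$ be a sequence with $a_n>0$ for all $n\in\mathbb{Z}^d$ such that, for some $\epsilon>0$, $a_n(1+|n|)^{2+\epsilon}$ is bounded over $n\in\mathbb{Z}^d$. Put $V^\omega(n)=a_nq^\omega(n)$ and $H^\omega=\Delta+V^\omega$ on $\ell^2(\mathbb{Z}^d)$. Then for almost every $\omega$ the sequences of measures $\{\mu_{L,E}^\omega\}_{L\in\mathbb{N}}$ and $\{\mu_{L,E}^0\}_{L\in\mathbb{N}}$ have the same limit points as $L\to\infty$ in the sense of distributions on $\mathbb{R}$.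
   Context: On $\ell^2(\mathbb{Z}^d)$ the operator $\Delta$ is $(\Delta u)(n)=\sum_{|m-n|=1}u(m)$ (sum over the $2d$ nearest neighbours of $n$; no diagonal term), with spectrum $[-2d,2d]$, and $V^\omega$ acts as multiplication, $(V^\omega u)(m)=V^\omega(m)u(m)$. For $L\in\mathbb{N}$ let $\Lambda_L=\{n=(n_1,\dots,n_d)\in\mathbb{Z}^d: |n_i|\le L,\ i=1,\dots,d\}$ and let $\chi_{\Lambda_L}$ be the orthogonal projection onto $\ell^2(\Lambda_L)$. Define the finite matrices, acting on $\ell^2(\Lambda_L)$, $$\Delta_{L,E}=(L+1)\chi_{\Lambda_L}(\Delta-E)\chi_{\Lambda_L},\qquad H^\omega_{L,E}=(L+1)\chi_{\Lambda_L}(H^\omega-E)\chi_{\Lambda_L}.$$ For a self-adjoint operator $A$, $E_A(\cdot)$ denotes its projection-valued spectral measure. The positive measures on $\mathbb{R}$ in question are $$\mu_{L,E}^0(\cdot)=\frac{1}{(2L+1)^{d-1}}\mathrm{Tr}\big(E_{\Delta_{L,E}}(\cdot)\big),\qquad \mu_{L,E}^\omega(\cdot)=\frac{1}{(2L+1)^{d-1}}\mathrm{Tr}\big(E_{H^\omega_{L,E}}(\cdot)\big),$$ i.e. the eigenvalue counting measures (with multiplicity) divided by $(2L+1)^{d-1}$. A limit point in the sense of distributions of a sequence of measures $\{\mu_L\}$ is a distribution $\Psi$ on $\mathbb{R}$ such that along some subsequence $L_k\to\infty$ one has $\int f\,d\mu_{L_k}\to\Psi(f)$ for every $f\in C_0^\infty(\mathbb{R})$.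 *)

theory Defs
  imports "HOL-Probability.Probability"
begin

section \<open>Finite-dimensional \<open>\<ell>\<^sup>2\<close> spaces and spectral measures\<close>

text \<open>
  For a finite set \<open>\<Lambda>\<close>, the Hilbert space \<open>\<ell>\<^sup>2(\<Lambda>)\<close> is represented by the complex functions
  on the ambient type that vanish off \<open>\<Lambda>\<close>. Operators are plain functions on functions; the
  definitions in this section are meant for finite \<open>\<Lambda>\<close> and self-adjoint \<open>A\<close> on \<open>\<ell>\<^sup>2(\<Lambda>)\<close>.
\<close>

definition ell2_on :: "'a set \<Rightarrow> ('a \<Rightarrow> complex) set" where
  "ell2_on \<Lambda> = {u. \<forall>x. x \<notin> \<Lambda> \<longrightarrow> u x = 0}"

definition ell2_inner :: "'a set \<Rightarrow> ('a \<Rightarrow> complex) \<Rightarrow> ('a \<Rightarrow> complex) \<Rightarrow> complex" where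
  "ell2_inner \<Lambda> u v = (\<Sum>x\<in>\<Lambda>. cnj (u x) * v x)"

definition eigenspace_on ::
    "'a set \<Rightarrow> (('a \<Rightarrow> complex) \<Rightarrow> 'a \<Rightarrow> complex) \<Rightarrow> real \<Rightarrow> ('a \<Rightarrow> complex) set" where
  "eigenspace_on \<Lambda> A t = {u \<in> ell2_on \<Lambda>. A u = (\<lambda>x. complex_of_real t * u x)}"

definition eigenvalues_on :: "'a set \<Rightarrow> (('a \<Rightarrow> complex) \<Rightarrow> 'a \<Rightarrow> complex) \<Rightarrow> real set" where
  "eigenvalues_on \<Lambda> A = {t. \<exists>u\<in>eigenspace_on \<Lambda> A t. u \<noteq> (\<lambda>_. 0)}"

definition orth_proj :: "'a set \<Rightarrow> ('a \<Rightarrow> complex) set \<Rightarrow> ('a \<Rightarrow> complex) \<Rightarrow> 'a \<Rightarrow> complex" where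
  "orth_proj \<Lambda> S u = (THE v. v \<in> S \<and> (\<forall>w\<in>S. ell2_inner \<Lambda> w (\<lambda>x. u x - v x) = 0))"

text \<open>
  The projection-valued spectral measure \<open>E\<^sub>A(B)\<close>: as the space is finite-dimensional, it is the
  sum of the orthogonal projections onto the eigenspaces of the eigenvalues lying in \<open>B\<close>.
\<close>

definition spectral_proj ::
    "'a set \<Rightarrow> (('a \<Rightarrow> complex) \<Rightarrow> 'a \<Rightarrow> complex) \<Rightarrow> real set \<Rightarrow> ('a \<Rightarrow> complex) \<Rightarrow> 'a \<Rightarrow> complex" where
  "spectral_proj \<Lambda> A B u =
     (\<lambda>x. \<Sum>t\<in>eigenvalues_on \<Lambda> A \<inter> B. orth_proj \<Lambda> (eigenspace_on \<Lambda> A t) u x)"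

definition trace_on :: "'a set \<Rightarrow> (('a \<Rightarrow> complex) \<Rightarrow> 'a \<Rightarrow> complex) \<Rightarrow> complex" where
  "trace_on \<Lambda> T = (\<Sum>x\<in>\<Lambda>. T (\<lambda>y. if y = x then 1 else 0) x)"

section \<open>Operators on the lattice \<open>\<int>\<^sup>d\<close>, with \<open>d = CARD('d)\<close>\<close>

text \<open>Euclidean norm of a lattice point.\<close>

definition lattice_norm :: "int ^ 'd \<Rightarrow> real" where
  "lattice_norm n = norm (\<chi> i. real_of_int (n $ i))"

definition lattice_laplacian :: "(int ^ 'd \<Rightarrow> complex) \<Rightarrow> int ^ 'd \<Rightarrow> complex" where
  "lattice_laplacian u n = (\<Sum>m | lattice_norm (m - n) = 1. u m)"

definition schroedinger_op ::
    "(int ^ 'd \<Rightarrow> real) \<Rightarrow> (int ^ 'd \<Rightarrow> complex) \<Rightarrow> int ^ 'd \<Rightarrow> complex" where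
  "schroedinger_op V u n = lattice_laplacian u n + complex_of_real (V n) * u n"

definition lattice_box :: "nat \<Rightarrow> (int ^ 'd) set" where
  "lattice_box L = {n. \<forall>i. \<bar>n $ i\<bar> \<le> int L}"

definition restrict_to :: "'a set \<Rightarrow> ('a \<Rightarrow> complex) \<Rightarrow> 'a \<Rightarrow> complex" where
  "restrict_to \<Lambda> u = (\<lambda>x. if x \<in> \<Lambda> then u x else 0)"

text \<open>\<open>(L + 1) \<chi>\<^sub>\<Lambda> (T - E) \<chi>\<^sub>\<Lambda>\<close> for \<open>\<Lambda> = lattice_box L\<close>.\<close>

definition scaled_box_op ::
    "nat \<Rightarrow> real \<Rightarrow> ((int ^ 'd \<Rightarrow> complex) \<Rightarrow> int ^ 'd \<Rightarrow> complex)
      \<Rightarrow> (int ^ 'd \<Rightarrow> complex) \<Rightarrow> int ^ 'd \<Rightarrow> complex" where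
  "scaled_box_op L E T u =
     (let v = restrict_to (lattice_box L) u
      in (\<lambda>n. of_nat (L + 1) * restrict_to (lattice_box L) (\<lambda>m. T v m - complex_of_real E * v m) n))"

text \<open>The trace of a spectral projection is real and nonnegative, so \<open>Re\<close> and \<open>ennreal\<close> lose nothing.\<close>

definition local_measure ::
    "nat \<Rightarrow> real \<Rightarrow> ((int ^ 'd \<Rightarrow> complex) \<Rightarrow> int ^ 'd \<Rightarrow> complex) \<Rightarrow> real measure" where
  "local_measure L E T = measure_of UNIV (sets borel)
     (\<lambda>B. ennreal (Re (trace_on (lattice_box L) (spectral_proj (lattice_box L) (scaled_box_op L E T) B))
                   / (2 * real L + 1) ^ (CARD('d) - 1)))"

section \<open>Distributions on \<open>\<real>\<close> and distributional limit points\<close>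

definition nth_derivative :: "nat \<Rightarrow> (real \<Rightarrow> complex) \<Rightarrow> real \<Rightarrow> complex" where
  "nth_derivative k = (\<lambda>g x. vector_derivative g (at x)) ^^ k"

definition test_function :: "(real \<Rightarrow> complex) \<Rightarrow> bool" where
  "test_function f \<longleftrightarrow>
     (\<forall>k x. nth_derivative k f differentiable (at x)) \<and> compact (closure {x. f x \<noteq> 0})"

text \<open>
  Values of a functional at arguments that are not test functions are irrelevant and left
  unconstrained. Continuity is the usual seminorm estimate on each compact set.
\<close>

definition is_distribution :: "((real \<Rightarrow> complex) \<Rightarrow> complex) \<Rightarrow> bool" where
  "is_distribution \<Psi> \<longleftrightarrow>
     (\<forall>f g. test_function f \<longrightarrow> test_function g \<longrightarrow> \<Psi> (\<lambda>x. f x + g x) = \<Psi> f + \<Psi> g) \<and>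
     (\<forall>c f. test_function f \<longrightarrow> \<Psi> (\<lambda>x. c * f x) = c * \<Psi> f) \<and>
     (\<forall>K. compact K \<longrightarrow> (\<exists>C N. \<forall>f. test_function f \<longrightarrow> closure {x. f x \<noteq> 0} \<subseteq> K \<longrightarrow>
        cmod (\<Psi> f) \<le> C * (\<Sum>k\<le>N. SUP x. cmod (nth_derivative k f x))))"

definition distributional_limit_point ::
    "(nat \<Rightarrow> real measure) \<Rightarrow> ((real \<Rightarrow> complex) \<Rightarrow> complex) \<Rightarrow> bool" where
  "distributional_limit_point \<mu> \<Psi> \<longleftrightarrow> is_distribution \<Psi> \<and>
     (\<exists>r. strict_mono r \<and>
        (\<forall>f. test_function f \<longrightarrow> (\<lambda>k. integral\<^sup>L (\<mu> (r k)) f) \<longlonglongrightarrow> \<Psi> f))"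

end

theory Submission
  imports Defs "HOL-Computational_Algebra.Fundamental_Theorem_Algebra"
begin

text \<open>
  Going from \<open>\<Delta>\<close> to \<open>H\<^sup>\<omega>\<close> changes the matrix on the box by the diagonal matrix with entries
  \<open>(L + 1) a n q n\<close>. The trace of \<open>f\<close> of a Hermitian matrix is Lipschitz with respect to the
  trace norm of the matrix, with constant \<open>sup |f'|\<close> (\<open>trace_lipschitz\<close>), so for a test
  function \<open>f\<close> the integrals against the two measures differ by at most
  \[ \sup |f'| \cdot \frac{L + 1}{(2 L + 1)^{d - 1}} \sum_{n \in \Lambda_L} |a_n q_n|. \]
  Almost surely this tends to \<open>0\<close>, simultaneously for all \<open>f\<close>
  (\<open>AE_potential_sum_negligible\<close>), and then the two sequences have the same limits along
  every subsequence.

  The Lipschitz estimate comes from comparing eigenbases \<open>e\<close> of \<open>A\<close> and \<open>g\<close> of \<open>B = A + W\<close>. The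
  squared overlaps of \<open>e\<close> and \<open>g\<close> form a doubly stochastic matrix, and a first order expansion
  of \<open>f\<close> gives the estimate up to an error \<open>C \<Sum> (w x)\<^sup>2\<close> (\<open>trace_perturbation_quadratic\<close>).
  Inserting the intermediate operators \<open>A + (k / n) W\<close> reduces the error to a fraction \<open>1 / n\<close>
  of itself. The existence of eigenbases
  (\<open>eigenbasis_exists\<close>) is reduced to the fundamental theorem of algebra by way of Krylov
  vectors.

  For the probabilistic part, only the first moment is available. The weighted sum
  \<open>\<Sum> |a n q n| / (1 + |n|)\<^sup>d\<^sup>-\<^sup>2\<close>, with the maximum norm of \<open>n\<close>, has finite expectation:
  the shell of radius \<open>k\<close> has \<open>O(k\<^sup>d\<^sup>-\<^sup>1)\<close> points and the weights are \<open>O(k\<^sup>-\<^sup>2\<^sup>-\<^sup>\<epsilon>)\<close>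
  (\<open>shell_weight_bound\<close>). Hence the sum is almost surely finite, and since \<open>d - 2 > 0\<close>
  Kronecker's lemma (\<open>kronecker_power\<close>) yields the decay of the averages.
\<close>

section \<open>Inner products on a finite set\<close>

lemma ell2_inner_cnj: "cnj (ell2_inner \<Lambda> u v) = ell2_inner \<Lambda> v u"
  by (simp add: ell2_inner_def mult.commute)

lemma ell2_inner_sum_right:
  "ell2_inner \<Lambda> u (\<lambda>x. \<Sum>i\<in>I. c i * v i x) = (\<Sum>i\<in>I. c i * ell2_inner \<Lambda> u (v i))"
  by (simp add: ell2_inner_def sum_distrib_left mult_ac sum.swap[of _ I])

lemma ell2_inner_sum_left:
  "ell2_inner \<Lambda> (\<lambda>x. \<Sum>i\<in>I. c i * v i x) u = (\<Sum>i\<in>I. cnj (c i) * ell2_inner \<Lambda> (v i) u)"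
  by (simp add: ell2_inner_def sum_distrib_left sum_distrib_right mult_ac sum.swap[of _ I])

lemma ell2_inner_diff_right:
  "ell2_inner \<Lambda> u (\<lambda>x. v x - w x) = ell2_inner \<Lambda> u v - ell2_inner \<Lambda> u w"
  by (simp add: ell2_inner_def algebra_simps sum_subtractf)

lemma ell2_inner_scale_right: "ell2_inner \<Lambda> u (\<lambda>x. c * v x) = c * ell2_inner \<Lambda> u v"
  by (simp add: ell2_inner_def sum_distrib_left mult_ac)

lemma ell2_inner_scale_left: "ell2_inner \<Lambda> (\<lambda>x. c * u x) v = cnj c * ell2_inner \<Lambda> u v"
  by (simp add: ell2_inner_def sum_distrib_left mult_ac)

lemma ell2_inner_self: "ell2_inner \<Lambda> u u = of_real (\<Sum>x\<in>\<Lambda>. (cmod (u x))\<^sup>2)"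
  by (simp add: ell2_inner_def complex_norm_square mult.commute del: of_real_power)

lemma ell2_inner_self_eq_0:
  assumes "finite \<Lambda>" "u \<in> ell2_on \<Lambda>" "ell2_inner \<Lambda> u u = 0"
  shows "u = (\<lambda>_. 0)"
proof -
  have "(\<Sum>x\<in>\<Lambda>. (cmod (u x))\<^sup>2) = 0"
    using assms(3) by (simp only: ell2_inner_self of_real_eq_0_iff)
  then have "\<forall>x\<in>\<Lambda>. u x = 0" using assms(1) by (simp add: sum_nonneg_eq_0_iff)
  then show ?thesis using assms(2) by (auto simp: ell2_on_def)
qed

lemma ell2_on_sum: "(\<And>i. i \<in> I \<Longrightarrow> v i \<in> ell2_on \<Lambda>) \<Longrightarrow> (\<lambda>x. \<Sum>i\<in>I. c i * v i x) \<in> ell2_on \<Lambda>"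
  by (auto simp: ell2_on_def)

section \<open>Linear dependence\<close>

text \<open>
  Gaussian elimination: if some \<open>f j\<close> does not vanish at the new point \<open>x\<close>, subtracting
  multiples of it clears the equation at \<open>x\<close> at the price of one index. With \<open>I\<close> as the
  unknowns and \<open>\<Lambda>\<close> as the equations, an underdetermined homogeneous system has a nonzero
  solution; with \<open>\<Lambda>\<close> as the domain, more than \<open>card \<Lambda>\<close> functions on \<open>\<Lambda>\<close> are dependent. Both
  readings are used below.
\<close>

lemma linear_dependence:
  fixes f :: "'i \<Rightarrow> 'a \<Rightarrow> complex"
  assumes "finite \<Lambda>" "finite I" "card \<Lambda> < card I"
  shows "\<exists>c. (\<exists>i\<in>I. c i \<noteq> 0) \<and> (\<forall>x\<in>\<Lambda>. (\<Sum>i\<in>I. c i * f i x) = 0)"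
  using assms
proof (induction \<Lambda> arbitrary: I f rule: finite_induct)
  case empty
  then have "I \<noteq> {}" by auto
  then show ?case by (intro exI[of _ "\<lambda>_. 1"]) auto
next
  case (insert x \<Lambda>)
  show ?case
  proof (cases "\<forall>i\<in>I. f i x = 0")
    case True
    have "card \<Lambda> < card I" using insert by simp
    from insert.IH[OF insert.prems(1) this, of f] obtain c where
      "\<exists>i\<in>I. c i \<noteq> 0" "\<forall>y\<in>\<Lambda>. (\<Sum>i\<in>I. c i * f i y) = 0" by blast
    then show ?thesis using True by (intro exI[of _ c]) auto
  next
    case False
    then obtain j where j: "j \<in> I" "f j x \<noteq> 0" by blast
    define J where "J = I - {j}"
    have I: "I = insert j J" "j \<notin> J" "finite J" using j insert.prems by (auto simp: J_def)
    have "card \<Lambda> < card J" using insert I by simp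
    from insert.IH[OF I(3) this, of "\<lambda>i y. f i y - f i x / f j x * f j y"] obtain c where
      c: "\<exists>i\<in>J. c i \<noteq> 0" "\<forall>y\<in>\<Lambda>. (\<Sum>i\<in>J. c i * (f i y - f i x / f j x * f j y)) = 0" by blast
    define b where "b = (\<lambda>i. if i = j then - (\<Sum>i\<in>J. c i * f i x) / f j x else c i)"
    have b: "(\<Sum>i\<in>I. b i * f i y) = (\<Sum>i\<in>J. c i * (f i y - f i x / f j x * f j y))" for y
    proof -
      have "(\<Sum>i\<in>I. b i * f i y) = b j * f j y + (\<Sum>i\<in>J. c i * f i y)"
        using I by (simp add: b_def) (intro sum.cong, auto)
      then show ?thesis
        by (simp add: b_def right_diff_distrib sum_subtractf sum_distrib_right sum_divide_distrib
              mult.assoc)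
    qed
    show ?thesis
    proof (intro exI[of _ b] conjI ballI)
      show "\<exists>i\<in>I. b i \<noteq> 0" using c(1) I by (auto simp: b_def)
    next
      fix y assume "y \<in> insert x \<Lambda>"
      then show "(\<Sum>i\<in>I. b i * f i y) = 0"
        using c(2) j by (auto simp: b)
    qed
  qed
qed

section \<open>The spectral theorem on a finite set\<close>

text \<open>
  The length \<open>n\<close> is a parameter because an eigenbasis is built one vector at a time;
  \<open>n = card \<Lambda>\<close> is a full eigenbasis, with eigenvalues \<open>l i\<close> repeated by multiplicity.
\<close>

definition eigenfamily ::
    "'a set \<Rightarrow> (('a \<Rightarrow> complex) \<Rightarrow> 'a \<Rightarrow> complex) \<Rightarrow> nat \<Rightarrow> (nat \<Rightarrow> 'a \<Rightarrow> complex) \<Rightarrow> (nat \<Rightarrow> real) \<Rightarrow> bool"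
  where
  "eigenfamily \<Lambda> A n e l \<longleftrightarrow>
     (\<forall>i<n. e i \<in> ell2_on \<Lambda> \<and> A (e i) = (\<lambda>x. of_real (l i) * e i x)) \<and>
     (\<forall>i<n. \<forall>j<n. ell2_inner \<Lambda> (e i) (e j) = (if i = j then 1 else 0))"

definition orthonormal_basis :: "'a set \<Rightarrow> (nat \<Rightarrow> 'a \<Rightarrow> complex) \<Rightarrow> bool" where
  "orthonormal_basis \<Lambda> e \<longleftrightarrow>
     (\<forall>i<card \<Lambda>. e i \<in> ell2_on \<Lambda>) \<and>
     (\<forall>i<card \<Lambda>. \<forall>j<card \<Lambda>. ell2_inner \<Lambda> (e i) (e j) = (if i = j then 1 else 0))"

lemma eigenfamily_basis: "eigenfamily \<Lambda> A (card \<Lambda>) e l \<Longrightarrow> orthonormal_basis \<Lambda> e"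
  by (simp add: eigenfamily_def orthonormal_basis_def)

text \<open>
  Only the action of \<open>A\<close> on \<open>ell2_on \<Lambda>\<close> is constrained, so an operator given on all functions
  of the ambient type qualifies through its restriction.
\<close>

locale selfadjoint_on =
  fixes \<Lambda> :: "'a set" and A :: "('a \<Rightarrow> complex) \<Rightarrow> 'a \<Rightarrow> complex"
  assumes finite_support: "finite \<Lambda>"
    and maps: "u \<in> ell2_on \<Lambda> \<Longrightarrow> A u \<in> ell2_on \<Lambda>"
    and additive: "u \<in> ell2_on \<Lambda> \<Longrightarrow> v \<in> ell2_on \<Lambda> \<Longrightarrow> A (\<lambda>x. u x + v x) = (\<lambda>x. A u x + A v x)"
    and homogeneous: "u \<in> ell2_on \<Lambda> \<Longrightarrow> A (\<lambda>x. c * u x) = (\<lambda>x. c * A u x)"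
    and symmetric: "u \<in> ell2_on \<Lambda> \<Longrightarrow> v \<in> ell2_on \<Lambda> \<Longrightarrow>
      ell2_inner \<Lambda> (A u) v = ell2_inner \<Lambda> u (A v)"
begin

lemma zero_ell2: "(\<lambda>_. 0) \<in> ell2_on \<Lambda>"
  by (simp add: ell2_on_def)

lemma apply_zero: "A (\<lambda>_. 0) = (\<lambda>_. 0)"
  using homogeneous[OF zero_ell2, of 0] by simp

lemma apply_sum:
  assumes "finite I" "\<And>i. i \<in> I \<Longrightarrow> v i \<in> ell2_on \<Lambda>"
  shows "A (\<lambda>x. \<Sum>i\<in>I. c i * v i x) = (\<lambda>x. \<Sum>i\<in>I. c i * A (v i) x)"
  using assms
proof (induction I rule: finite_induct)
  case empty
  then show ?case by (simp add: apply_zero)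
next
  case (insert i I)
  have 1: "(\<lambda>x. c i * v i x) \<in> ell2_on \<Lambda>" using insert.prems by (auto simp: ell2_on_def)
  have 2: "(\<lambda>x. \<Sum>i\<in>I. c i * v i x) \<in> ell2_on \<Lambda>" using insert.prems by (intro ell2_on_sum) auto
  show ?case
    using insert additive[OF 1 2] by (simp add: homogeneous)
qed

lemma iterate_ell2: "u \<in> ell2_on \<Lambda> \<Longrightarrow> (A ^^ i) u \<in> ell2_on \<Lambda>"
  by (induction i) (auto intro: maps)

text \<open>
  This is \<open>p(A) u\<close> when \<open>degree p \<le> n\<close>. Fixing the range of summation independently of \<open>p\<close>
  makes the expression linear in \<open>p\<close> without case distinctions on degrees.
\<close>

definition poly_apply :: "nat \<Rightarrow> complex poly \<Rightarrow> ('a \<Rightarrow> complex) \<Rightarrow> 'a \<Rightarrow> complex" where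
  "poly_apply n p u = (\<lambda>x. \<Sum>i\<le>n. coeff p i * (A ^^ i) u x)"

lemma poly_apply_linear_factor:
  assumes "u \<in> ell2_on \<Lambda>" "degree q < n"
  shows "poly_apply n ([:- z, 1:] * q) u = (\<lambda>x. A (poly_apply n q u) x - z * poly_apply n q u x)"
proof -
  obtain m where n: "n = Suc m" using assms(2) by (cases n) auto
  have qn: "coeff q n = 0" using assms(2) by (simp add: coeff_eq_0)
  have A: "A (poly_apply n q u) = (\<lambda>x. \<Sum>i\<le>m. coeff q i * (A ^^ Suc i) u x)"
    unfolding poly_apply_def using qn n
    by (subst apply_sum) (auto simp: iterate_ell2 assms)
  show ?thesis
  proof
    fix x
    have eq: "[:- z, 1:] * q = pCons 0 q - smult z q" by simp
    have "(\<Sum>i\<le>n. coeff (pCons 0 q) i * (A ^^ i) u x) = (\<Sum>i\<le>m. coeff q i * (A ^^ Suc i) u x)"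
      unfolding n by (subst sum.atMost_Suc_shift) simp
    then show "poly_apply n ([:- z, 1:] * q) u x = A (poly_apply n q u) x - z * poly_apply n q u x"
      unfolding A eq by (simp only: poly_apply_def coeff_diff coeff_smult left_diff_distrib
          sum_subtractf sum_distrib_left mult.assoc)
  qed
qed

text \<open>
  Split a linear factor \<open>X - z\<close> off \<open>p\<close>, leaving \<open>q\<close>. Either \<open>q(A) u\<close> is nonzero, and then
  it is an eigenvector for \<open>z\<close>, or \<open>q\<close> is an annihilator of \<open>u\<close> of smaller degree. In degree
  \<open>0\<close> annihilation is impossible because \<open>u \<noteq> 0\<close>.
\<close>

lemma eigenvector_of_annihilator:
  assumes S: "S \<subseteq> ell2_on \<Lambda>"
    and S_sum: "\<And>(I :: nat set) c v. finite I \<Longrightarrow> (\<And>i. i \<in> I \<Longrightarrow> v i \<in> S) \<Longrightarrow> (\<lambda>x. \<Sum>i\<in>I. c i * v i x) \<in> S"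
    and S_inv: "\<And>v. v \<in> S \<Longrightarrow> A v \<in> S"
    and u: "u \<in> S" "u \<noteq> (\<lambda>_. 0)"
    and p: "p \<noteq> 0" "degree p \<le> n" "poly_apply n p u = (\<lambda>_. 0)"
  shows "\<exists>z w. w \<in> S \<and> w \<noteq> (\<lambda>_. 0) \<and> A w = (\<lambda>x. z * w x)"
  using p
proof (induction "degree p" arbitrary: p)
  case 0
  then obtain c where c: "p = [:c:]" "c \<noteq> 0" by (metis degree_eq_zeroE pCons_0_0)
  have "poly_apply n p u = (\<lambda>x. \<Sum>i\<le>n. if i = 0 then c * u x else 0)"
    unfolding poly_apply_def c by (intro ext sum.cong) (auto simp: coeff_pCons split: nat.split)
  also have "\<dots> = (\<lambda>x. c * u x)" by (subst sum.delta) auto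
  finally have "(\<lambda>x. c * u x) = (\<lambda>_. 0)" using 0(4) by simp
  then have "u = (\<lambda>_. 0)" using c by (auto simp: fun_eq_iff)
  then show ?case using u by simp
next
  case (Suc k)
  have "\<not> constant (poly p)" using Suc(2) by (simp add: constant_degree)
  then obtain z where "poly p z = 0" using fundamental_theorem_of_algebra by blast
  then obtain q where q: "p = [:- z, 1:] * q" by (metis poly_eq_0_iff_dvd dvdE)
  have q0: "q \<noteq> 0" using q Suc by auto
  then have deg: "degree p = Suc (degree q)" unfolding q by (subst degree_mult_eq) auto
  have uell: "u \<in> ell2_on \<Lambda>" using u S by auto
  define w where "w = poly_apply n q u"
  have it: "(A ^^ i) u \<in> S" for i by (induction i) (auto intro: S_inv u)
  have wS: "w \<in> S" unfolding w_def poly_apply_def by (intro S_sum) (auto simp: it)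
  have w: "(\<lambda>x. A w x - z * w x) = (\<lambda>_. 0)"
    using poly_apply_linear_factor[OF uell, of q n z] Suc(5) Suc(4) deg unfolding w_def q by simp
  show ?case
  proof (cases "w = (\<lambda>_. 0)")
    case True
    then show ?thesis using Suc(1)[of q] Suc(2,4) deg q0 by (simp add: w_def)
  next
    case False
    have "A w = (\<lambda>x. z * w x)" using w by (auto simp: fun_eq_iff)
    then show ?thesis using False wS by blast
  qed
qed

text \<open>
  The Krylov vectors \<open>u, A u, A\<^sup>2 u, \<dots>\<close>, one more of them than \<open>\<Lambda>\<close> has points, are linearly
  dependent; the dependence is a nonzero polynomial annihilating \<open>u\<close>. Closure of \<open>S\<close> under
  finite linear combinations keeps everything inside \<open>S\<close>.
\<close>

lemma eigenvector_in_invariant_subspace: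
  assumes S: "S \<subseteq> ell2_on \<Lambda>"
    and S_sum: "\<And>(I :: nat set) c v. finite I \<Longrightarrow> (\<And>i. i \<in> I \<Longrightarrow> v i \<in> S) \<Longrightarrow> (\<lambda>x. \<Sum>i\<in>I. c i * v i x) \<in> S"
    and S_inv: "\<And>v. v \<in> S \<Longrightarrow> A v \<in> S"
    and u: "u \<in> S" "u \<noteq> (\<lambda>_. 0)"
  shows "\<exists>z w. w \<in> S \<and> w \<noteq> (\<lambda>_. 0) \<and> A w = (\<lambda>x. z * w x)"
proof -
  define n where "n = card \<Lambda>"
  obtain c :: "nat \<Rightarrow> complex" where c: "\<exists>i\<in>{..n}. c i \<noteq> 0"
      "\<forall>x\<in>\<Lambda>. (\<Sum>i\<le>n. c i * (A ^^ i) u x) = 0"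
    using linear_dependence[OF finite_support, of "{..n}" "\<lambda>i. (A ^^ i) u"] by (auto simp: n_def)
  define p where "p = (\<Sum>i\<le>n. monom (c i) i)"
  have cp: "coeff p i = (if i \<le> n then c i else 0)" for i
    by (simp add: p_def coeff_sum sum.delta)
  have "p \<noteq> 0" using c(1) cp by (metis atMost_iff coeff_0)
  moreover have "degree p \<le> n" by (rule degree_le) (simp add: cp)
  moreover have "poly_apply n p u = (\<lambda>_. 0)"
  proof
    fix x
    have "(A ^^ i) u x = 0" if "x \<notin> \<Lambda>" for i
      using iterate_ell2[of u i] u S that by (auto simp: ell2_on_def)
    then show "poly_apply n p u x = 0"
      using c(2) by (cases "x \<in> \<Lambda>") (auto simp: poly_apply_def cp)
  qed
  ultimately show ?thesis
    using eigenvector_of_annihilator[OF assms] by blast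
qed

lemma eigenvalue_real:
  assumes "w \<in> ell2_on \<Lambda>" "w \<noteq> (\<lambda>_. 0)" "A w = (\<lambda>x. z * w x)"
  shows "z = of_real (Re z)"
proof -
  have "cnj z * ell2_inner \<Lambda> w w = z * ell2_inner \<Lambda> w w"
    using symmetric[OF assms(1,1)] by (simp add: assms(3) ell2_inner_scale_left ell2_inner_scale_right)
  moreover have "ell2_inner \<Lambda> w w \<noteq> 0"
    using ell2_inner_self_eq_0[OF finite_support assms(1)] assms(2) by blast
  ultimately have "cnj z = z" by simp
  then show ?thesis by (metis complex_is_Real_iff Reals_cnj_iff of_real_Re)
qed

text \<open>
  The orthogonal complement of the vectors found so far is nonzero by counting equations, and
  invariant under \<open>A\<close> by self-adjointness, so it contains a further eigenvector.
\<close>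

lemma eigenfamily_extend:
  assumes e: "eigenfamily \<Lambda> A n e l" and n: "n < card \<Lambda>"
  shows "\<exists>w t. eigenfamily \<Lambda> A (Suc n) (e(n := w)) (l(n := t))"
proof -
  define S where "S = {v \<in> ell2_on \<Lambda>. \<forall>i<n. ell2_inner \<Lambda> (e i) v = 0}"
  obtain c where c: "\<exists>x\<in>\<Lambda>. c x \<noteq> 0" "\<forall>i\<in>{..<n}. (\<Sum>x\<in>\<Lambda>. c x * cnj (e i x)) = 0"
    using linear_dependence[of "{..<n}" \<Lambda> "\<lambda>x i. cnj (e i x)"] n finite_support by auto
  define u where "u = (\<lambda>x. if x \<in> \<Lambda> then c x else 0)"
  have u: "u \<in> S" "u \<noteq> (\<lambda>_. 0)"
    using c by (auto simp: S_def ell2_on_def u_def ell2_inner_def mult.commute fun_eq_iff)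
  have S: "S \<subseteq> ell2_on \<Lambda>" by (auto simp: S_def)
  have S_sum: "(\<lambda>x. \<Sum>i\<in>I. c i * v i x) \<in> S"
    if "finite I" "\<And>i. i \<in> I \<Longrightarrow> v i \<in> S" for I :: "nat set" and c v
    using that by (auto simp: S_def ell2_inner_sum_right intro!: ell2_on_sum)
  have S_inv: "A v \<in> S" if v: "v \<in> S" for v
  proof -
    have "ell2_inner \<Lambda> (e i) (A v) = 0" if i: "i < n" for i
    proof -
      have ei: "e i \<in> ell2_on \<Lambda>" "A (e i) = (\<lambda>x. of_real (l i) * e i x)"
        using e i by (auto simp: eigenfamily_def)
      have "ell2_inner \<Lambda> (e i) (A v) = ell2_inner \<Lambda> (A (e i)) v"
        using symmetric[OF ei(1)] v by (auto simp: S_def)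
      also have "\<dots> = 0" using v i by (simp add: ei(2) ell2_inner_scale_left S_def)
      finally show ?thesis .
    qed
    then show ?thesis using v by (auto simp: S_def maps)
  qed
  obtain z w where w: "w \<in> S" "w \<noteq> (\<lambda>_. 0)" "A w = (\<lambda>x. z * w x)"
    using eigenvector_in_invariant_subspace[OF S S_sum S_inv u] by blast
  have well: "w \<in> ell2_on \<Lambda>" using w S by auto
  have z: "z = of_real (Re z)" using eigenvalue_real[OF well w(2,3)] .
  define r where "r = sqrt (\<Sum>x\<in>\<Lambda>. (cmod (w x))\<^sup>2)"
  have r2: "ell2_inner \<Lambda> w w = of_real (r\<^sup>2)"
    by (simp add: ell2_inner_self r_def sum_nonneg)
  have r0: "r \<noteq> 0"
    using ell2_inner_self_eq_0[OF finite_support well] w(2) r2 by auto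
  define w' where "w' = (\<lambda>x. of_real (1 / r) * w x)"
  have w'ell: "w' \<in> ell2_on \<Lambda>" using well by (auto simp: w'_def ell2_on_def)
  have w'A: "A w' = (\<lambda>x. of_real (Re z) * w' x)"
    using homogeneous[OF well, of "of_real (1 / r)"] w(3) z by (simp add: w'_def mult_ac)
  have w'n: "ell2_inner \<Lambda> w' w' = 1"
    using r0 by (simp add: w'_def ell2_inner_scale_left ell2_inner_scale_right r2 power2_eq_square
        del: of_real_divide of_real_power) (simp add: field_simps)
  have w'e: "ell2_inner \<Lambda> (e i) w' = 0" "ell2_inner \<Lambda> w' (e i) = 0" if "i < n" for i
  proof -
    show *: "ell2_inner \<Lambda> (e i) w' = 0"
      using w(1) that unfolding w'_def ell2_inner_scale_right by (auto simp: S_def)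
    show "ell2_inner \<Lambda> w' (e i) = 0"
      using * ell2_inner_cnj[of \<Lambda> "e i" w'] by simp
  qed
  have "eigenfamily \<Lambda> A (Suc n) (e(n := w')) (l(n := Re z))"
    using e w'ell w'A w'n w'e by (auto simp: eigenfamily_def less_Suc_eq)
  then show ?thesis by blast
qed

lemma eigenbasis_exists: "\<exists>e l. eigenfamily \<Lambda> A (card \<Lambda>) e l"
proof -
  have "\<exists>e l. eigenfamily \<Lambda> A n e l" if "n \<le> card \<Lambda>" for n
    using that
  proof (induction n)
    case 0
    show ?case by (simp add: eigenfamily_def)
  next
    case (Suc n)
    then show ?case using eigenfamily_extend by (meson Suc_le_eq less_imp_le_nat)
  qed
  then show ?thesis by blast
qed

end

text \<open>
  A nonzero remainder \<open>r\<close> would be orthogonal to every \<open>e i\<close>, giving \<open>card \<Lambda> + 1\<close> nonzero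
  mutually orthogonal functions supported on \<open>\<Lambda>\<close>, which cannot be linearly dependent.
\<close>

lemma orthonormal_expansion:
  assumes fin: "finite \<Lambda>" and basis: "orthonormal_basis \<Lambda> e" and u: "u \<in> ell2_on \<Lambda>"
  shows "u = (\<lambda>x. \<Sum>i<card \<Lambda>. ell2_inner \<Lambda> (e i) u * e i x)"
proof -
  have e: "e i \<in> ell2_on \<Lambda>" if "i < card \<Lambda>" for i
    using basis that by (simp add: orthonormal_basis_def)
  have orth: "ell2_inner \<Lambda> (e i) (e j) = (if i = j then 1 else 0)"
    if "i < card \<Lambda>" "j < card \<Lambda>" for i j
    using basis that by (simp add: orthonormal_basis_def)
  define N where "N = card \<Lambda>"
  define r where "r = (\<lambda>x. u x - (\<Sum>i<N. ell2_inner \<Lambda> (e i) u * e i x))"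
  have rell: "r \<in> ell2_on \<Lambda>" using u e by (auto simp: r_def ell2_on_def N_def)
  have re: "ell2_inner \<Lambda> (e j) r = 0" if "j < N" for j
  proof -
    have "ell2_inner \<Lambda> (e j) r = ell2_inner \<Lambda> (e j) u
        - (\<Sum>i<N. ell2_inner \<Lambda> (e i) u * (if j = i then 1 else 0))"
      unfolding r_def ell2_inner_diff_right ell2_inner_sum_right
      using orth that by (simp add: N_def)
    then show ?thesis using that by (simp add: if_distrib sum.delta cong: if_cong)
  qed
  define f where "f = (\<lambda>i. if i = N then r else e i)"
  obtain c where c: "\<exists>i\<in>{..N}. c i \<noteq> 0" "\<forall>x\<in>\<Lambda>. (\<Sum>i\<le>N. c i * f i x) = 0"
    using linear_dependence[OF fin, of "{..N}" f] by (auto simp: N_def)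
  have *: "(\<Sum>i\<le>N. c i * ell2_inner \<Lambda> g (f i)) = 0" for g
    unfolding ell2_inner_sum_right[symmetric] using c(2) by (simp add: ell2_inner_def)
  have cN: "c j = 0" if "j < N" for j
  proof -
    have "(\<Sum>i\<le>N. c i * ell2_inner \<Lambda> (e j) (f i))
        = (\<Sum>i\<le>N. if i = j then c j else 0)"
      using that orth by (intro sum.cong) (auto simp: f_def re N_def)
    then show ?thesis using *[of "e j"] that by (simp add: sum.delta)
  qed
  then have "c N \<noteq> 0" using c(1) by (metis atMost_iff le_neq_implies_less)
  moreover have "(\<Sum>i\<le>N. c i * ell2_inner \<Lambda> r (f i)) = c N * ell2_inner \<Lambda> r r"
    using cN by (simp add: lessThan_Suc_atMost[symmetric] f_def)
  ultimately have "ell2_inner \<Lambda> r r = 0" using *[of r] by simp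
  then have "r = (\<lambda>_. 0)" by (rule ell2_inner_self_eq_0[OF fin rell])
  then show ?thesis by (auto simp: r_def N_def fun_eq_iff)
qed

section \<open>Perturbation of traces by a potential\<close>

lemma parseval:
  assumes "finite \<Lambda>" "orthonormal_basis \<Lambda> e" "v \<in> ell2_on \<Lambda>"
  shows "ell2_inner \<Lambda> u v = (\<Sum>i<card \<Lambda>. ell2_inner \<Lambda> u (e i) * ell2_inner \<Lambda> (e i) v)"
proof -
  have "ell2_inner \<Lambda> u v = ell2_inner \<Lambda> u (\<lambda>x. \<Sum>i<card \<Lambda>. ell2_inner \<Lambda> (e i) v * e i x)"
    using arg_cong[OF orthonormal_expansion[OF assms], of "ell2_inner \<Lambda> u"] .
  then show ?thesis unfolding ell2_inner_sum_right by (simp add: mult.commute)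
qed

lemma parseval_norm:
  assumes "finite \<Lambda>" "orthonormal_basis \<Lambda> e" "v \<in> ell2_on \<Lambda>"
  shows "(\<Sum>i<card \<Lambda>. (cmod (ell2_inner \<Lambda> (e i) v))\<^sup>2) = (\<Sum>x\<in>\<Lambda>. (cmod (v x))\<^sup>2)"
proof -
  have "complex_of_real (\<Sum>x\<in>\<Lambda>. (cmod (v x))\<^sup>2)
      = (\<Sum>i<card \<Lambda>. ell2_inner \<Lambda> v (e i) * ell2_inner \<Lambda> (e i) v)"
    using parseval[OF assms, of v] by (simp only: ell2_inner_self)
  also have "\<dots> = complex_of_real (\<Sum>i<card \<Lambda>. (cmod (ell2_inner \<Lambda> (e i) v))\<^sup>2)"
    unfolding of_real_sum complex_norm_square
    by (intro sum.cong) (auto simp: ell2_inner_cnj mult.commute)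
  finally show ?thesis by (simp only: of_real_eq_iff)
qed

text \<open>
  The rows of the unitary matrix \<open>(e i x)\<close> are orthonormal, hence so are its columns: this is
  Parseval for the point mass at \<open>x\<close>.
\<close>

lemma basis_column_norm:
  assumes "finite \<Lambda>" "orthonormal_basis \<Lambda> e" "x \<in> \<Lambda>"
  shows "(\<Sum>i<card \<Lambda>. (cmod (e i x))\<^sup>2) = 1"
proof -
  define \<delta> where "\<delta> = (\<lambda>y. if y = x then 1 else 0 :: complex)"
  have "\<delta> \<in> ell2_on \<Lambda>" using assms(3) by (auto simp: \<delta>_def ell2_on_def)
  note parseval_norm[OF assms(1,2) this]
  moreover have "ell2_inner \<Lambda> (e i) \<delta> = cnj (e i x)" for i
    using assms(1,3) by (simp add: ell2_inner_def \<delta>_def if_distrib sum.delta cong: if_cong)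
  moreover have "(\<Sum>y\<in>\<Lambda>. (cmod (\<delta> y))\<^sup>2) = 1"
    using assms(1,3) by (simp add: \<delta>_def if_distrib[of cmod] if_distrib[of "\<lambda>r. r\<^sup>2"] sum.delta cong: if_cong)
  ultimately show ?thesis by simp
qed

lemma selfadjoint_on_add_potential:
  assumes "selfadjoint_on \<Lambda> A"
  shows "selfadjoint_on \<Lambda> (\<lambda>u x. A u x + of_real (w x) * u x)"
proof -
  interpret selfadjoint_on \<Lambda> A by fact
  show ?thesis
  proof
    show "finite \<Lambda>" by (rule finite_support)
  next
    fix u assume "u \<in> ell2_on \<Lambda>"
    then show "(\<lambda>x. A u x + of_real (w x) * u x) \<in> ell2_on \<Lambda>"
      using maps by (auto simp: ell2_on_def)
  next
    fix u v assume "u \<in> ell2_on \<Lambda>" "v \<in> ell2_on \<Lambda>"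
    then show "(\<lambda>x. A (\<lambda>x. u x + v x) x + of_real (w x) * (u x + v x))
        = (\<lambda>x. A u x + of_real (w x) * u x + (A v x + of_real (w x) * v x))"
      by (auto simp: additive algebra_simps)
  next
    fix u c assume "u \<in> ell2_on \<Lambda>"
    then show "(\<lambda>x. A (\<lambda>x. c * u x) x + of_real (w x) * (c * u x))
        = (\<lambda>x. c * (A u x + of_real (w x) * u x))"
      by (auto simp: homogeneous algebra_simps)
  next
    fix u v assume uv: "u \<in> ell2_on \<Lambda>" "v \<in> ell2_on \<Lambda>"
    have "ell2_inner \<Lambda> (\<lambda>x. A u x + of_real (w x) * u x) v
        = ell2_inner \<Lambda> (A u) v + (\<Sum>x\<in>\<Lambda>. of_real (w x) * (cnj (u x) * v x))"
      by (simp add: ell2_inner_def algebra_simps sum.distrib)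
    moreover have "ell2_inner \<Lambda> u (\<lambda>x. A v x + of_real (w x) * v x)
        = ell2_inner \<Lambda> u (A v) + (\<Sum>x\<in>\<Lambda>. of_real (w x) * (cnj (u x) * v x))"
      by (simp add: ell2_inner_def algebra_simps sum.distrib)
    ultimately show "ell2_inner \<Lambda> (\<lambda>x. A u x + of_real (w x) * u x) v
        = ell2_inner \<Lambda> u (\<lambda>x. A v x + of_real (w x) * v x)"
      using symmetric[OF uv] by simp
  qed
qed

text \<open>
  The overlaps \<open>p i j = |\<langle>g i, e j\<rangle>|\<^sup>2\<close> of the two eigenbases form a doubly stochastic matrix, so
  the difference of the traces is \<open>\<Sum> p i j (f (m i) - f (l j))\<close>. Expand \<open>f\<close> to first order at
  \<open>l j\<close>. Since \<open>\<langle>g i, (B - A) e j\<rangle> = (m i - l j) \<langle>g i, e j\<rangle>\<close>, Parseval turns the first and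
  second moments of \<open>m i - l j\<close> under \<open>p\<close> into \<open>\<langle>e j, W e j\<rangle>\<close> and \<open>|W e j|\<^sup>2\<close>, where
  \<open>W = B - A\<close> is multiplication by \<open>w\<close>. Summing over \<open>j\<close> leaves \<open>\<Sum> |w x|\<close> and \<open>\<Sum> (w x)\<^sup>2\<close>
  because the columns of \<open>e\<close> have norm \<open>1\<close>.
\<close>

lemma trace_perturbation_quadratic:
  fixes f f' :: "real \<Rightarrow> complex"
  assumes A: "selfadjoint_on \<Lambda> A" and B: "selfadjoint_on \<Lambda> B"
    and BA: "\<And>u. u \<in> ell2_on \<Lambda> \<Longrightarrow> B u = (\<lambda>x. A u x + of_real (w x) * u x)"
    and e: "eigenfamily \<Lambda> A (card \<Lambda>) e l" and g: "eigenfamily \<Lambda> B (card \<Lambda>) g m"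
    and K: "\<And>t. cmod (f' t) \<le> K"
    and C: "\<And>s t. cmod (f s - f t - of_real (s - t) * f' t) \<le> C * (s - t)\<^sup>2"
  shows "cmod ((\<Sum>i<card \<Lambda>. f (m i)) - (\<Sum>j<card \<Lambda>. f (l j)))
    \<le> K * (\<Sum>x\<in>\<Lambda>. \<bar>w x\<bar>) + C * (\<Sum>x\<in>\<Lambda>. (w x)\<^sup>2)"
proof -
  interpret A: selfadjoint_on \<Lambda> A by fact
  interpret B: selfadjoint_on \<Lambda> B by fact
  define N where "N = card \<Lambda>"
  note fin = A.finite_support
  note eb = eigenfamily_basis[OF e] and gb = eigenfamily_basis[OF g]
  have ee: "e j \<in> ell2_on \<Lambda>" "A (e j) = (\<lambda>x. of_real (l j) * e j x)"
      "ell2_inner \<Lambda> (e j) (e j) = 1" if "j < N" for j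
    using e that by (auto simp: eigenfamily_def N_def)
  have gg: "g i \<in> ell2_on \<Lambda>" "B (g i) = (\<lambda>x. of_real (m i) * g i x)"
      "ell2_inner \<Lambda> (g i) (g i) = 1" if "i < N" for i
    using g that by (auto simp: eigenfamily_def N_def)
  define W where "W = (\<lambda>j x. of_real (w x) * e j x)"
  have W: "W j \<in> ell2_on \<Lambda>" if "j < N" for j
    using ee(1)[OF that] by (auto simp: W_def ell2_on_def)
  define p where "p = (\<lambda>i j. (cmod (ell2_inner \<Lambda> (g i) (e j)))\<^sup>2)"
  have p0: "p i j \<ge> 0" for i j by (simp add: p_def)
  have norm1: "(\<Sum>x\<in>\<Lambda>. (cmod (u x))\<^sup>2) = 1" if "ell2_inner \<Lambda> u u = 1" for u
    using that unfolding ell2_inner_self by (simp only: of_real_eq_1_iff)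
  have p_col: "(\<Sum>i<N. p i j) = 1" if "j < N" for j
    using parseval_norm[OF fin gb ee(1)[OF that]] norm1[OF ee(3)[OF that]] by (simp add: p_def N_def)
  have p_row: "(\<Sum>j<N. p i j) = 1" if "i < N" for i
  proof -
    have "p i j = (cmod (ell2_inner \<Lambda> (e j) (g i)))\<^sup>2" for j
      unfolding p_def by (subst ell2_inner_cnj[symmetric]) simp
    then show ?thesis
      using parseval_norm[OF fin eb gg(1)[OF that]] norm1[OF gg(3)[OF that]] by (simp add: N_def)
  qed
  have entry: "ell2_inner \<Lambda> (g i) (W j) = of_real (m i - l j) * ell2_inner \<Lambda> (g i) (e j)"
    if i: "i < N" and j: "j < N" for i j
  proof -
    have "W j = (\<lambda>x. B (e j) x - A (e j) x)"
      using BA[OF ee(1)[OF j]] by (simp add: W_def)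
    then have "ell2_inner \<Lambda> (g i) (W j)
        = ell2_inner \<Lambda> (B (g i)) (e j) - ell2_inner \<Lambda> (g i) (A (e j))"
      by (simp add: ell2_inner_diff_right B.symmetric[OF gg(1)[OF i] ee(1)[OF j]])
    then show ?thesis
      by (simp add: gg(2)[OF i] ee(2)[OF j] ell2_inner_scale_left ell2_inner_scale_right algebra_simps)
  qed
  have first: "(\<Sum>i<N. p i j * (m i - l j)) = (\<Sum>x\<in>\<Lambda>. w x * (cmod (e j x))\<^sup>2)" if j: "j < N" for j
  proof -
    have "ell2_inner \<Lambda> (e j) (W j) = (\<Sum>i<N. of_real (p i j * (m i - l j)))"
      unfolding parseval[OF fin gb W[OF j], of "e j"] N_def[symmetric]
    proof (intro sum.cong refl)
      fix i assume "i \<in> {..<N}"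
      then show "ell2_inner \<Lambda> (e j) (g i) * ell2_inner \<Lambda> (g i) (W j)
          = of_real (p i j * (m i - l j))"
        using j by (simp add: entry p_def complex_norm_square ell2_inner_cnj mult_ac del: of_real_power)
    qed
    moreover have "ell2_inner \<Lambda> (e j) (W j) = of_real (\<Sum>x\<in>\<Lambda>. w x * (cmod (e j x))\<^sup>2)"
      by (simp add: ell2_inner_def W_def complex_norm_square mult_ac del: of_real_power)
    ultimately have "complex_of_real (\<Sum>i<N. p i j * (m i - l j))
        = complex_of_real (\<Sum>x\<in>\<Lambda>. w x * (cmod (e j x))\<^sup>2)"
      by (simp only: of_real_sum)
    then show ?thesis by (simp only: of_real_eq_iff)
  qed
  have second: "(\<Sum>i<N. p i j * (m i - l j)\<^sup>2) = (\<Sum>x\<in>\<Lambda>. (w x)\<^sup>2 * (cmod (e j x))\<^sup>2)"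
    if j: "j < N" for j
  proof -
    have "(\<Sum>i<N. p i j * (m i - l j)\<^sup>2) = (\<Sum>i<N. (cmod (ell2_inner \<Lambda> (g i) (W j)))\<^sup>2)"
      using j by (intro sum.cong refl) (simp add: entry norm_mult p_def power_mult_distrib
          del: of_real_diff)
    also have "\<dots> = (\<Sum>x\<in>\<Lambda>. (cmod (W j x))\<^sup>2)"
      using parseval_norm[OF fin gb W[OF j]] by (simp add: N_def)
    finally show ?thesis by (simp add: W_def norm_mult power_mult_distrib)
  qed
  define R where "R = (\<lambda>i j. f (m i) - f (l j) - of_real (m i - l j) * f' (l j))"
  have split: "(\<Sum>i<N. f (m i)) - (\<Sum>j<N. f (l j))
     = (\<Sum>j<N. f' (l j) * of_real (\<Sum>i<N. p i j * (m i - l j)))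
       + (\<Sum>j<N. \<Sum>i<N. of_real (p i j) * R i j)"
  proof -
    have "(\<Sum>i<N. f (m i)) = (\<Sum>i<N. of_real (\<Sum>j<N. p i j) * f (m i))"
      by (intro sum.cong) (auto simp: p_row simp del: of_real_sum)
    also have "\<dots> = (\<Sum>j<N. \<Sum>i<N. of_real (p i j) * f (m i))"
      by (subst sum.swap) (simp add: sum_distrib_right)
    finally have 1: "(\<Sum>i<N. f (m i)) = (\<Sum>j<N. \<Sum>i<N. of_real (p i j) * f (m i))" .
    have "(\<Sum>j<N. f (l j)) = (\<Sum>j<N. of_real (\<Sum>i<N. p i j) * f (l j))"
      by (intro sum.cong) (auto simp: p_col simp del: of_real_sum)
    then have 2: "(\<Sum>j<N. f (l j)) = (\<Sum>j<N. \<Sum>i<N. of_real (p i j) * f (l j))"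
      by (simp add: sum_distrib_right)
    show ?thesis
      unfolding 1 2 R_def
      by (simp add: sum_subtractf[symmetric] sum.distrib[symmetric] sum_distrib_left algebra_simps)
  qed
  have b1: "cmod (f' (l j) * of_real (\<Sum>i<N. p i j * (m i - l j)))
      \<le> (\<Sum>x\<in>\<Lambda>. K * \<bar>w x\<bar> * (cmod (e j x))\<^sup>2)" if j: "j < N" for j
  proof -
    have K0: "0 \<le> K" using K[of 0] norm_ge_zero order_trans by blast
    have "cmod (f' (l j) * of_real (\<Sum>i<N. p i j * (m i - l j)))
        = cmod (f' (l j)) * \<bar>\<Sum>x\<in>\<Lambda>. w x * (cmod (e j x))\<^sup>2\<bar>"
      by (simp only: norm_mult norm_of_real first[OF j])
    also have "\<dots> \<le> K * (\<Sum>x\<in>\<Lambda>. \<bar>w x * (cmod (e j x))\<^sup>2\<bar>)"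
      by (intro mult_mono K K0 sum_abs) auto
    finally show ?thesis by (simp add: abs_mult sum_distrib_left mult_ac)
  qed
  have b2: "cmod (\<Sum>i<N. of_real (p i j) * R i j) \<le> (\<Sum>x\<in>\<Lambda>. C * (w x)\<^sup>2 * (cmod (e j x))\<^sup>2)"
    if j: "j < N" for j
  proof -
    have "cmod (\<Sum>i<N. of_real (p i j) * R i j) \<le> (\<Sum>i<N. p i j * (C * (m i - l j)\<^sup>2))"
      using C p0 by (intro sum_norm_le) (auto simp: norm_mult R_def simp del: of_real_diff intro!: mult_left_mono)
    also have "\<dots> = C * (\<Sum>i<N. p i j * (m i - l j)\<^sup>2)"
      by (simp add: sum_distrib_left mult_ac)
    finally show ?thesis by (simp add: second[OF j] sum_distrib_left mult_ac)
  qed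
  have swap: "(\<Sum>j<N. \<Sum>x\<in>\<Lambda>. h x * (cmod (e j x))\<^sup>2) = (\<Sum>x\<in>\<Lambda>. h x)" for h
  proof -
    have "(\<Sum>j<N. \<Sum>x\<in>\<Lambda>. h x * (cmod (e j x))\<^sup>2) = (\<Sum>x\<in>\<Lambda>. h x * (\<Sum>j<N. (cmod (e j x))\<^sup>2))"
      by (subst sum.swap) (simp add: sum_distrib_left)
    also have "\<dots> = (\<Sum>x\<in>\<Lambda>. h x)"
      using basis_column_norm[OF fin eb] by (intro sum.cong) (auto simp: N_def)
    finally show ?thesis .
  qed
  have "cmod ((\<Sum>i<N. f (m i)) - (\<Sum>j<N. f (l j)))
      \<le> (\<Sum>j<N. \<Sum>x\<in>\<Lambda>. K * \<bar>w x\<bar> * (cmod (e j x))\<^sup>2) + (\<Sum>j<N. \<Sum>x\<in>\<Lambda>. C * (w x)\<^sup>2 * (cmod (e j x))\<^sup>2)"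
    unfolding split using b1 b2 by (intro norm_triangle_le add_mono sum_norm_le) auto
  also have "\<dots> = K * (\<Sum>x\<in>\<Lambda>. \<bar>w x\<bar>) + C * (\<Sum>x\<in>\<Lambda>. (w x)\<^sup>2)"
    by (simp only: swap sum_distrib_left)
  finally show ?thesis by (simp add: N_def)
qed

text \<open>
  Move from \<open>A\<close> to \<open>B\<close> in \<open>n\<close> equal steps: by the quadratic estimate they cost
  \<open>K \<Sum> |w x| + C \<Sum> (w x)\<^sup>2 / n\<close> together, and \<open>n\<close> is arbitrary. A bound linear in \<open>w\<close> is
  essential for the application, where \<open>w\<close> carries the factor \<open>L + 1\<close> and is a random variable
  with a first moment only.
\<close>

lemma trace_lipschitz:
  fixes f f' :: "real \<Rightarrow> complex"
  assumes A: "selfadjoint_on \<Lambda> A" and B: "selfadjoint_on \<Lambda> B"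
    and BA: "\<And>u. u \<in> ell2_on \<Lambda> \<Longrightarrow> B u = (\<lambda>x. A u x + of_real (w x) * u x)"
    and e: "eigenfamily \<Lambda> A (card \<Lambda>) e l" and g: "eigenfamily \<Lambda> B (card \<Lambda>) g m"
    and K: "\<And>t. cmod (f' t) \<le> K"
    and C: "\<And>s t. cmod (f s - f t - of_real (s - t) * f' t) \<le> C * (s - t)\<^sup>2"
  shows "cmod ((\<Sum>i<card \<Lambda>. f (m i)) - (\<Sum>j<card \<Lambda>. f (l j))) \<le> K * (\<Sum>x\<in>\<Lambda>. \<bar>w x\<bar>)"
proof -
  define S1 where "S1 = (\<Sum>x\<in>\<Lambda>. \<bar>w x\<bar>)"
  define S2 where "S2 = (\<Sum>x\<in>\<Lambda>. (w x)\<^sup>2)"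
  define T where "T = (\<lambda>\<tau> u x. A u x + of_real (\<tau> * w x) * u x)"
  have T: "selfadjoint_on \<Lambda> (T \<tau>)" for \<tau>
    unfolding T_def by (rule selfadjoint_on_add_potential[OF A])
  have "\<exists>h k. eigenfamily \<Lambda> (T \<tau>) (card \<Lambda>) h k" for \<tau>
    by (rule selfadjoint_on.eigenbasis_exists[OF T])
  then obtain h k where hk: "\<And>\<tau>. eigenfamily \<Lambda> (T \<tau>) (card \<Lambda>) (h \<tau>) (k \<tau>)" by metis
  define F where "F = (\<lambda>\<tau>. \<Sum>i<card \<Lambda>. f (k \<tau> i))"
  have step: "cmod (F \<tau>' - F \<tau>) \<le> K * (\<bar>\<tau>' - \<tau>\<bar> * S1) + C * ((\<tau>' - \<tau>)\<^sup>2 * S2)" for \<tau> \<tau>'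
  proof -
    have "cmod (F \<tau>' - F \<tau>)
        \<le> K * (\<Sum>x\<in>\<Lambda>. \<bar>(\<tau>' - \<tau>) * w x\<bar>) + C * (\<Sum>x\<in>\<Lambda>. ((\<tau>' - \<tau>) * w x)\<^sup>2)"
      unfolding F_def
      by (rule trace_perturbation_quadratic[OF T T _ hk hk K C]) (simp add: T_def algebra_simps)
    then show ?thesis
      by (simp only: abs_mult power_mult_distrib sum_distrib_left[symmetric] S1_def S2_def)
  qed
  \<comment> \<open>The quadratic bound with perturbation \<open>0\<close> says that the trace does not depend on
    the choice of eigenbasis.\<close>
  have start: "(\<Sum>j<card \<Lambda>. f (l j)) = F 0"
    using trace_perturbation_quadratic[OF T[of 0] A _ hk e K C, of "\<lambda>_. 0"]
    by (simp add: T_def F_def)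
  have final: "(\<Sum>i<card \<Lambda>. f (m i)) = F 1"
    using trace_perturbation_quadratic[OF T[of 1] B _ hk g K C, of "\<lambda>_. 0"]
    by (simp add: T_def F_def BA)
  have bound: "cmod (F 1 - F 0) \<le> K * S1 + C * S2 / real (Suc n)" for n
  proof -
    define t where "t = (\<lambda>i. real i / real (Suc n))"
    have tt: "t (Suc i) - t i = 1 / real (Suc n)" for i
      unfolding t_def by (simp add: diff_divide_distrib[symmetric])
    have "F 1 - F 0 = F (t (Suc n)) - F (t 0)" by (simp add: t_def)
    also have "\<dots> = (\<Sum>i<Suc n. F (t (Suc i)) - F (t i))"
      by (rule sum_lessThan_telescope[symmetric])
    finally have "cmod (F 1 - F 0) \<le> (\<Sum>i<Suc n. cmod (F (t (Suc i)) - F (t i)))"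
      using norm_sum by metis
    also have "\<dots> \<le> (\<Sum>i<Suc n. K * (1 / real (Suc n) * S1) + C * ((1 / real (Suc n))\<^sup>2 * S2))"
    proof (rule sum_mono)
      fix i
      show "cmod (F (t (Suc i)) - F (t i))
          \<le> K * (1 / real (Suc n) * S1) + C * ((1 / real (Suc n))\<^sup>2 * S2)"
        using step[of "t (Suc i)" "t i"] by (simp add: tt)
    qed
    also have "\<dots> = real (Suc n) * (K * (1 / real (Suc n) * S1) + C * ((1 / real (Suc n))\<^sup>2 * S2))"
      by simp
    also have "\<dots> = K * S1 + C * S2 / real (Suc n)"
      by (simp add: field_simps power2_eq_square del: of_nat_Suc)
    finally show ?thesis .
  qed
  have "(\<lambda>n. K * S1 + C * S2 / real (Suc n)) \<longlonglongrightarrow> K * S1 + 0"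
    by (intro tendsto_add tendsto_const LIMSEQ_Suc[OF lim_const_over_n])
  then have "cmod (F 1 - F 0) \<le> K * S1 + 0"
    by (rule LIMSEQ_le_const) (use bound in blast)
  then show ?thesis by (simp add: start final S1_def)
qed

section \<open>Spectral measures and their integrals\<close>

context selfadjoint_on
begin

lemma eigenspace_coefficient_zero:
  assumes e: "eigenfamily \<Lambda> A (card \<Lambda>) e l" and u: "u \<in> eigenspace_on \<Lambda> A t"
    and i: "i < card \<Lambda>" "l i \<noteq> t"
  shows "ell2_inner \<Lambda> (e i) u = 0"
proof -
  have ei: "e i \<in> ell2_on \<Lambda>" "A (e i) = (\<lambda>x. of_real (l i) * e i x)"
    using e i by (auto simp: eigenfamily_def)
  have u': "u \<in> ell2_on \<Lambda>" "A u = (\<lambda>x. of_real t * u x)"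
    using u by (auto simp: eigenspace_on_def)
  have "of_real (l i) * ell2_inner \<Lambda> (e i) u = of_real t * ell2_inner \<Lambda> (e i) u"
    using symmetric[OF ei(1) u'(1)] by (simp add: ei(2) u'(2) ell2_inner_scale_left ell2_inner_scale_right)
  then show ?thesis using i(2) by simp
qed

lemma eigenvalues_on_eq:
  assumes e: "eigenfamily \<Lambda> A (card \<Lambda>) e l"
  shows "eigenvalues_on \<Lambda> A = l ` {..<card \<Lambda>}"
proof (intro equalityI subsetI)
  fix t assume "t \<in> eigenvalues_on \<Lambda> A"
  then obtain u where u: "u \<in> eigenspace_on \<Lambda> A t" "u \<noteq> (\<lambda>_. 0)"
    by (auto simp: eigenvalues_on_def)
  show "t \<in> l ` {..<card \<Lambda>}"
  proof (rule ccontr)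
    assume "t \<notin> l ` {..<card \<Lambda>}"
    then have "ell2_inner \<Lambda> (e i) u = 0" if "i < card \<Lambda>" for i
      using eigenspace_coefficient_zero[OF e u(1) that] that by auto
    moreover have "u \<in> ell2_on \<Lambda>" using u by (simp add: eigenspace_on_def)
    ultimately have "u = (\<lambda>_. 0)"
      by (subst orthonormal_expansion[OF finite_support eigenfamily_basis[OF e]]) auto
    then show False using u by simp
  qed
next
  fix t assume "t \<in> l ` {..<card \<Lambda>}"
  then obtain i where i: "i < card \<Lambda>" "t = l i" by auto
  then have "e i \<in> eigenspace_on \<Lambda> A t" "ell2_inner \<Lambda> (e i) (e i) = 1"
    using e by (auto simp: eigenfamily_def eigenspace_on_def)
  moreover from this have "e i \<noteq> (\<lambda>_. 0)" by (auto simp: ell2_inner_def)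
  ultimately show "t \<in> eigenvalues_on \<Lambda> A" by (auto simp: eigenvalues_on_def)
qed

text \<open>
  The right-hand side lies in the eigenspace, and its difference from \<open>u\<close> is orthogonal to
  it, as an element of the eigenspace has no components along the \<open>e i\<close> with \<open>l i \<noteq> t\<close>.
  Two candidates differ by a vector of the eigenspace orthogonal to itself.
\<close>

lemma orth_proj_eigenspace:
  assumes e: "eigenfamily \<Lambda> A (card \<Lambda>) e l"
  shows "orth_proj \<Lambda> (eigenspace_on \<Lambda> A t) u
    = (\<lambda>x. \<Sum>i\<in>{i \<in> {..<card \<Lambda>}. l i = t}. ell2_inner \<Lambda> (e i) u * e i x)"
proof -
  define J where "J = {i \<in> {..<card \<Lambda>}. l i = t}"
  define v where "v = (\<lambda>x. \<Sum>i\<in>J. ell2_inner \<Lambda> (e i) u * e i x)"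
  have J: "finite J" "\<And>i. i \<in> J \<Longrightarrow> i < card \<Lambda> \<and> l i = t" by (auto simp: J_def)
  have ee: "e i \<in> ell2_on \<Lambda>" "A (e i) = (\<lambda>x. of_real (l i) * e i x)" if "i < card \<Lambda>" for i
    using e that by (auto simp: eigenfamily_def)
  have vell: "v \<in> ell2_on \<Lambda>" unfolding v_def using J ee by (intro ell2_on_sum) auto
  have "A v = (\<lambda>x. \<Sum>i\<in>J. ell2_inner \<Lambda> (e i) u * A (e i) x)"
    unfolding v_def using J ee by (intro apply_sum) auto
  also have "\<dots> = (\<lambda>x. of_real t * v x)"
    using J ee by (auto simp: v_def sum_distrib_left mult_ac intro!: sum.cong)
  finally have vS: "v \<in> eigenspace_on \<Lambda> A t" using vell by (simp add: eigenspace_on_def)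
  have ev: "ell2_inner \<Lambda> (e j) v = ell2_inner \<Lambda> (e j) u" if "j \<in> J" for j
  proof -
    have "ell2_inner \<Lambda> (e j) v = (\<Sum>i\<in>J. if i = j then ell2_inner \<Lambda> (e j) u else 0)"
      unfolding v_def ell2_inner_sum_right using e J that
      by (intro sum.cong) (auto simp: eigenfamily_def)
    then show ?thesis using J that by (simp add: sum.delta)
  qed
  have orth: "ell2_inner \<Lambda> w (\<lambda>x. u x - v x) = 0" if w: "w \<in> eigenspace_on \<Lambda> A t" for w
  proof -
    have well: "w \<in> ell2_on \<Lambda>" using w by (simp add: eigenspace_on_def)
    have "w = (\<lambda>x. \<Sum>i<card \<Lambda>. ell2_inner \<Lambda> (e i) w * e i x)"
      by (rule orthonormal_expansion[OF finite_support eigenfamily_basis[OF e] well])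
    from arg_cong[OF this, of "\<lambda>w'. ell2_inner \<Lambda> w' (\<lambda>x. u x - v x)"]
    have "ell2_inner \<Lambda> w (\<lambda>x. u x - v x)
        = (\<Sum>i<card \<Lambda>. cnj (ell2_inner \<Lambda> (e i) w) * ell2_inner \<Lambda> (e i) (\<lambda>x. u x - v x))"
      by (simp only: ell2_inner_sum_left)
    also have "\<dots> = 0"
    proof (intro sum.neutral ballI)
      fix i assume i: "i \<in> {..<card \<Lambda>}"
      show "cnj (ell2_inner \<Lambda> (e i) w) * ell2_inner \<Lambda> (e i) (\<lambda>x. u x - v x) = 0"
      proof (cases "l i = t")
        case True
        then show ?thesis using ev[of i] i by (simp add: ell2_inner_diff_right J_def)
      next
        case False
        then show ?thesis using eigenspace_coefficient_zero[OF e w, of i] i by simp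
      qed
    qed
    finally show ?thesis .
  qed
  have "orth_proj \<Lambda> (eigenspace_on \<Lambda> A t) u = v"
    unfolding orth_proj_def
  proof (rule the_equality)
    show "v \<in> eigenspace_on \<Lambda> A t \<and>
        (\<forall>w\<in>eigenspace_on \<Lambda> A t. ell2_inner \<Lambda> w (\<lambda>x. u x - v x) = 0)"
      using vS orth by blast
  next
    fix v' assume v': "v' \<in> eigenspace_on \<Lambda> A t \<and>
        (\<forall>w\<in>eigenspace_on \<Lambda> A t. ell2_inner \<Lambda> w (\<lambda>x. u x - v' x) = 0)"
    define d where "d = (\<lambda>x. v' x - v x)"
    have v'ell: "v' \<in> ell2_on \<Lambda>" "A v' = (\<lambda>x. of_real t * v' x)"
      using v' by (auto simp: eigenspace_on_def)
    have vA: "A v = (\<lambda>x. of_real t * v x)" using vS by (auto simp: eigenspace_on_def)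
    have mvell: "(\<lambda>x. - 1 * v x) \<in> ell2_on \<Lambda>" using vell by (auto simp: ell2_on_def)
    have dell: "d \<in> ell2_on \<Lambda>" using v'ell vell by (auto simp: d_def ell2_on_def)
    have "A d = (\<lambda>x. A v' x + - 1 * A v x)"
      using additive[OF v'ell(1) mvell] homogeneous[OF vell, of "- 1"] by (simp add: d_def)
    then have "d \<in> eigenspace_on \<Lambda> A t"
      using dell by (auto simp: eigenspace_on_def v'ell vA d_def algebra_simps)
    then have "ell2_inner \<Lambda> d (\<lambda>x. u x - v x) - ell2_inner \<Lambda> d (\<lambda>x. u x - v' x) = 0"
      using orth v' by simp
    then have "ell2_inner \<Lambda> d d = 0"
      unfolding ell2_inner_diff_right[symmetric] by (simp add: d_def)
    then have "d = (\<lambda>_. 0)" by (rule ell2_inner_self_eq_0[OF finite_support dell])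
    then show "v' = v" by (auto simp: d_def fun_eq_iff)
  qed
  then show ?thesis by (simp add: v_def J_def)
qed

lemma trace_spectral_proj:
  assumes e: "eigenfamily \<Lambda> A (card \<Lambda>) e l"
  shows "trace_on \<Lambda> (spectral_proj \<Lambda> A B) = of_nat (card {i \<in> {..<card \<Lambda>}. l i \<in> B})"
proof -
  define N where "N = card \<Lambda>"
  have "spectral_proj \<Lambda> A B u x = (\<Sum>i\<in>{i \<in> {..<N}. l i \<in> B}. ell2_inner \<Lambda> (e i) u * e i x)" for u x
  proof -
    have "spectral_proj \<Lambda> A B u x
        = (\<Sum>t\<in>l ` {..<N} \<inter> B. \<Sum>i\<in>{i \<in> {..<N}. l i = t}. ell2_inner \<Lambda> (e i) u * e i x)"
      by (simp add: spectral_proj_def eigenvalues_on_eq[OF e] orth_proj_eigenspace[OF e] N_def)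
    also have "\<dots> = (\<Sum>t\<in>l ` {..<N} \<inter> B. \<Sum>i\<in>{i \<in> {i \<in> {..<N}. l i \<in> B}. l i = t}.
        ell2_inner \<Lambda> (e i) u * e i x)"
      by (intro sum.cong) auto
    also have "\<dots> = (\<Sum>i\<in>{i \<in> {..<N}. l i \<in> B}. ell2_inner \<Lambda> (e i) u * e i x)"
      by (rule sum.group) auto
    finally show ?thesis .
  qed
  then have "trace_on \<Lambda> (spectral_proj \<Lambda> A B)
      = (\<Sum>x\<in>\<Lambda>. \<Sum>i\<in>{i \<in> {..<N}. l i \<in> B}. cnj (e i x) * e i x)"
    using finite_support unfolding trace_on_def
    by (simp add: ell2_inner_def if_distrib sum.delta cong: if_cong)
  also have "\<dots> = (\<Sum>i\<in>{i \<in> {..<N}. l i \<in> B}. ell2_inner \<Lambda> (e i) (e i))"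
    unfolding ell2_inner_def by (rule sum.swap)
  also have "\<dots> = (\<Sum>i\<in>{i \<in> {..<N}. l i \<in> B}. 1)"
    using e by (intro sum.cong) (auto simp: eigenfamily_def N_def)
  finally show ?thesis by (simp add: N_def)
qed

end

text \<open>
  By the trace formula the set function defining the measure agrees with the image under \<open>l\<close>
  of the point measure on the indices \<open>i < card (lattice_box L)\<close> with constant weight; this
  both shows that it is a measure and evaluates its integrals.
\<close>

lemma integral_local_measure:
  fixes T :: "(int ^ 'd \<Rightarrow> complex) \<Rightarrow> int ^ 'd \<Rightarrow> complex" and f :: "real \<Rightarrow> complex"
  assumes A: "selfadjoint_on (lattice_box L) (scaled_box_op L E T)"
    and e: "eigenfamily (lattice_box L) (scaled_box_op L E T) (card (lattice_box L :: (int ^ 'd) set)) e l"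
    and f: "f \<in> borel_measurable borel"
  shows "integral\<^sup>L (local_measure L E T) f
    = (\<Sum>i<card (lattice_box L :: (int ^ 'd) set). f (l i)) / of_real ((2 * real L + 1) ^ (CARD('d) - 1))"
proof -
  define N where "N = card (lattice_box L :: (int ^ 'd) set)"
  define c where "c = (2 * real L + 1) ^ (CARD('d) - 1)"
  have c: "c > 0" by (simp add: c_def)
  define P where "P = point_measure {..<N} (\<lambda>_. ennreal (1 / c))"
  define D where "D = distr P borel l"
  have l: "l \<in> measurable P borel" by (simp add: P_def point_measure_def)
  have eD: "ennreal (Re (trace_on (lattice_box L) (spectral_proj (lattice_box L) (scaled_box_op L E T) B)) / c)
      = emeasure D B" if "B \<in> sets borel" for B
  proof -
    have "emeasure D B = emeasure P (l -` B \<inter> {..<N})"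
      unfolding D_def by (subst emeasure_distr[OF l that]) (simp add: P_def space_point_measure)
    also have "\<dots> = (\<Sum>i\<in>l -` B \<inter> {..<N}. ennreal (1 / c))"
      unfolding P_def by (rule emeasure_point_measure_finite) auto
    also have "\<dots> = ennreal (real (card (l -` B \<inter> {..<N})) / c)"
      using c by (subst sum_ennreal) auto
    also have "l -` B \<inter> {..<N} = {i \<in> {..<N}. l i \<in> B}" by auto
    finally show ?thesis
      by (simp add: selfadjoint_on.trace_spectral_proj[OF A e] N_def)
  qed
  have "local_measure L E T = measure_of (space D) (sets D) (emeasure D)"
    unfolding local_measure_def c_def[symmetric]
    by (simp add: D_def) (rule measure_of_eq, auto simp: eD[unfolded D_def] sets.sigma_sets_eq[of borel, simplified])
  then have "local_measure L E T = D" by (simp add: measure_of_of_measure)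
  then have "integral\<^sup>L (local_measure L E T) f = integral\<^sup>L P (\<lambda>i. f (l i))"
    unfolding D_def by (simp add: integral_distr[OF l f])
  also have "\<dots> = (\<Sum>i<N. (1 / c) *\<^sub>R f (l i))"
    unfolding P_def using c by (intro lebesgue_integral_point_measure_finite) auto
  also have "\<dots> = (\<Sum>i<N. f (l i)) / of_real c"
    by (simp add: sum_divide_distrib scaleR_conv_of_real)
  finally show ?thesis by (simp add: N_def c_def)
qed

section \<open>Boxes and restricted Schroedinger operators\<close>

lemma card_lattice_box: "card (lattice_box L :: (int ^ 'd) set) = (2 * L + 1) ^ CARD('d)"
  and finite_lattice_box: "finite (lattice_box L :: (int ^ 'd) set)"
proof -
  define P where "P = PiE (UNIV :: 'd set) (\<lambda>_. {- int L..int L})"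
  have eq: "lattice_box L = vec_lambda ` P"
  proof (intro equalityI subsetI)
    fix n :: "int ^ 'd" assume "n \<in> lattice_box L"
    then have "vec_nth n \<in> P" by (auto simp: lattice_box_def P_def abs_le_iff minus_le_iff)
    then have "vec_lambda (vec_nth n) \<in> vec_lambda ` P" by (rule imageI)
    then show "n \<in> vec_lambda ` P" by simp
  qed (auto simp: lattice_box_def P_def abs_le_iff minus_le_iff PiE_iff)
  have inj: "inj_on (vec_lambda :: ('d \<Rightarrow> int) \<Rightarrow> int ^ 'd) P"
    by (rule inj_onI) (metis UNIV_I vec_lambda_inverse)
  show "finite (lattice_box L :: (int ^ 'd) set)"
    unfolding eq P_def by (intro finite_imageI finite_PiE) auto
  have "card P = (\<Prod>i\<in>(UNIV :: 'd set). card {- int L..int L})"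
    unfolding P_def by (rule card_PiE) simp
  also have "\<dots> = (2 * L + 1) ^ CARD('d)" by simp (simp add: nat_add_distrib nat_mult_distrib)
  finally show "card (lattice_box L :: (int ^ 'd) set) = (2 * L + 1) ^ CARD('d)"
    unfolding eq using inj by (simp add: card_image)
qed

lemma lattice_norm_component: "\<bar>real_of_int (n $ i)\<bar> \<le> lattice_norm n"
  using component_le_norm_cart[of "\<chi> i. real_of_int (n $ i)" i] by (simp add: lattice_norm_def)

lemma lattice_norm_minus_commute: "lattice_norm (m - n) = lattice_norm (n - m)"
proof -
  have "(\<chi> i. real_of_int ((m - n) $ i)) = - (\<chi> i. real_of_int ((n - m) $ i))"
    by (simp add: vec_eq_iff)
  then show ?thesis by (simp add: lattice_norm_def)
qed

lemma finite_neighbours: "finite {m :: int ^ 'd. lattice_norm (m - n) = 1}"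
proof (rule finite_subset)
  \<comment> \<open>Being at Euclidean distance \<open>1\<close> forces every coordinate to differ by at most \<open>1\<close>.\<close>
  show "{m. lattice_norm (m - n) = 1} \<subseteq> (\<lambda>k. k + n) ` lattice_box 1"
  proof
    fix m :: "int ^ 'd" assume m: "m \<in> {m. lattice_norm (m - n) = 1}"
    have "\<bar>(m - n) $ i\<bar> \<le> 1" for i
      using lattice_norm_component[of "m - n" i] m unfolding of_int_abs[symmetric]
      by (simp del: of_int_abs vector_minus_component)
    then have "m - n \<in> lattice_box 1"
      by (auto simp: lattice_box_def simp del: vector_minus_component)
    then show "m \<in> (\<lambda>k. k + n) ` lattice_box 1" by (metis diff_add_cancel imageI)
  qed
qed (simp add: finite_lattice_box)

lemma selfadjoint_on_real_symmetric_kernel: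
  fixes k :: "'a \<Rightarrow> 'a \<Rightarrow> real"
  assumes fin: "finite \<Lambda>" and sym: "\<And>x y. k x y = k y x"
    and A: "\<And>u. u \<in> ell2_on \<Lambda> \<Longrightarrow> A u = (\<lambda>x. if x \<in> \<Lambda> then \<Sum>y\<in>\<Lambda>. of_real (k x y) * u y else 0)"
  shows "selfadjoint_on \<Lambda> A"
proof
  show "finite \<Lambda>" by fact
next
  fix u assume u: "u \<in> ell2_on \<Lambda>"
  show "A u \<in> ell2_on \<Lambda>" unfolding A[OF u] by (simp add: ell2_on_def)
next
  fix u v assume u: "u \<in> ell2_on \<Lambda>" and v: "v \<in> ell2_on \<Lambda>"
  have "(\<lambda>x. u x + v x) \<in> ell2_on \<Lambda>" using u v by (simp add: ell2_on_def)
  from A[OF this] show "A (\<lambda>x. u x + v x) = (\<lambda>x. A u x + A v x)"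
    unfolding A[OF u] A[OF v] by (auto simp: distrib_left sum.distrib)
next
  fix u c assume u: "u \<in> ell2_on \<Lambda>"
  have "(\<lambda>x. c * u x) \<in> ell2_on \<Lambda>" using u by (simp add: ell2_on_def)
  from A[OF this] show "A (\<lambda>x. c * u x) = (\<lambda>x. c * A u x)"
    unfolding A[OF u] by (auto simp: sum_distrib_left mult_ac)
next
  fix u v assume u: "u \<in> ell2_on \<Lambda>" and v: "v \<in> ell2_on \<Lambda>"
  have "ell2_inner \<Lambda> (A u) v = (\<Sum>x\<in>\<Lambda>. \<Sum>y\<in>\<Lambda>. of_real (k x y) * cnj (u y) * v x)"
    unfolding ell2_inner_def A[OF u] by (simp add: sum_distrib_right)
  also have "\<dots> = (\<Sum>y\<in>\<Lambda>. \<Sum>x\<in>\<Lambda>. of_real (k x y) * cnj (u y) * v x)"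
    by (rule sum.swap)
  also have "\<dots> = ell2_inner \<Lambda> u (A v)"
    unfolding ell2_inner_def A[OF v] by (simp add: sum_distrib_left sym mult_ac)
  finally show "ell2_inner \<Lambda> (A u) v = ell2_inner \<Lambda> u (A v)" .
qed

lemma schroedinger_op_zero: "schroedinger_op (\<lambda>_. 0) = lattice_laplacian"
  by (simp add: schroedinger_op_def fun_eq_iff)

text \<open>
  On \<open>\<ell>\<^sup>2\<close> of the box the operator has a real symmetric kernel. Finiteness of the set of
  neighbours matters here, since a sum over an infinite set is \<open>0\<close> by convention.
\<close>

lemma selfadjoint_on_scaled_schroedinger:
  fixes V :: "int ^ 'd \<Rightarrow> real"
  shows "selfadjoint_on (lattice_box L) (scaled_box_op L E (schroedinger_op V))"
proof (rule selfadjoint_on_real_symmetric_kernel)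
  define k :: "int ^ 'd \<Rightarrow> int ^ 'd \<Rightarrow> real" where
    "k = (\<lambda>x y. real (L + 1) * ((if lattice_norm (y - x) = 1 then 1 else 0)
      + (if y = x then V x - E else 0)))"
  show "finite (lattice_box L :: (int ^ 'd) set)" by (rule finite_lattice_box)
  show "k x y = k y x" for x y by (simp add: k_def lattice_norm_minus_commute)
  fix u :: "int ^ 'd \<Rightarrow> complex" assume u: "u \<in> ell2_on (lattice_box L)"
  have r: "restrict_to (lattice_box L) u = u"
    using u by (auto simp: restrict_to_def ell2_on_def)
  have lap: "lattice_laplacian u x = (\<Sum>y\<in>lattice_box L. (if lattice_norm (y - x) = 1 then 1 else 0) * u y)"
    for x
  proof -
    have "lattice_laplacian u x = (\<Sum>y\<in>{y. lattice_norm (y - x) = 1} \<inter> lattice_box L. u y)"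
      unfolding lattice_laplacian_def using u
      by (intro sum.mono_neutral_right finite_neighbours) (auto simp: ell2_on_def)
    also have "\<dots> = (\<Sum>y\<in>lattice_box L. if y \<in> {y. lattice_norm (y - x) = 1} then u y else 0)"
      by (subst Int_commute) (rule sum.inter_restrict[OF finite_lattice_box])
    finally show ?thesis by (simp add: if_distrib[of "\<lambda>c. c * _"] cong: if_cong)
  qed
  have diag: "complex_of_real (V x - E) * u x
      = (\<Sum>y\<in>lattice_box L. of_real (if y = x then V x - E else 0) * u y)" if "x \<in> lattice_box L" for x
  proof -
    have "(\<Sum>y\<in>lattice_box L. of_real (if y = x then V x - E else 0) * u y)
        = (\<Sum>y\<in>lattice_box L. if y = x then of_real (V x - E) * u x else 0)"
      by (intro sum.cong) auto
    then show ?thesis using that by (simp add: sum.delta finite_lattice_box)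
  qed
  show "scaled_box_op L E (schroedinger_op V) u
    = (\<lambda>x. if x \<in> lattice_box L then \<Sum>y\<in>lattice_box L. complex_of_real (k x y) * u y else 0)"
  proof
    fix x
    show "scaled_box_op L E (schroedinger_op V) u x
      = (if x \<in> lattice_box L then \<Sum>y\<in>lattice_box L. complex_of_real (k x y) * u y else 0)"
    proof (cases "x \<in> lattice_box L")
      case True
      have "scaled_box_op L E (schroedinger_op V) u x
          = of_nat (L + 1) * (lattice_laplacian u x + of_real (V x - E) * u x)"
        using True unfolding scaled_box_op_def Let_def r
        by (simp add: restrict_to_def schroedinger_op_def algebra_simps)
      also have "\<dots> = (\<Sum>y\<in>lattice_box L. complex_of_real (k x y) * u y)"
        unfolding lap diag[OF True] sum.distrib[symmetric] sum_distrib_left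
        by (intro sum.cong refl) (auto simp: k_def algebra_simps)
      finally show ?thesis using True by simp
    qed (simp add: scaled_box_op_def Let_def r restrict_to_def)
  qed
qed

lemma scaled_schroedinger_perturbation:
  assumes "u \<in> ell2_on (lattice_box L)"
  shows "scaled_box_op L E (schroedinger_op V) u
    = (\<lambda>x. scaled_box_op L E lattice_laplacian u x + of_real ((real L + 1) * V x) * u x)"
proof -
  have r: "restrict_to (lattice_box L) u = u"
    using assms by (auto simp: restrict_to_def ell2_on_def)
  show ?thesis
    using assms unfolding scaled_box_op_def Let_def r
    by (auto simp: restrict_to_def schroedinger_op_def ell2_on_def algebra_simps)
qed

section \<open>Test functions and distributional limits\<close>

lemma vector_derivative_zero_open:
  fixes g :: "real \<Rightarrow> complex"
  assumes "open U" "\<And>x. x \<in> U \<Longrightarrow> g x = 0" "x \<in> U"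
  shows "vector_derivative g (at x) = 0"
proof -
  have "((\<lambda>_. 0) has_vector_derivative 0) (at x)" by (rule has_vector_derivative_const)
  then have "(g has_vector_derivative 0) (at x)"
    by (rule has_vector_derivative_transform_within_open[OF _ assms(1,3)]) (simp add: assms(2))
  then show ?thesis by (rule vector_derivative_at)
qed

lemma continuous_compact_support_bounded:
  fixes g :: "real \<Rightarrow> complex"
  assumes "compact S" "continuous_on UNIV g" "\<And>x. x \<notin> S \<Longrightarrow> g x = 0"
  shows "\<exists>K. \<forall>x. cmod (g x) \<le> K"
proof -
  have "bounded (g ` S)"
    by (intro compact_imp_bounded compact_continuous_image continuous_on_subset[OF assms(2)] assms(1)) simp
  then obtain K where K: "\<And>x. x \<in> S \<Longrightarrow> cmod (g x) \<le> K" by (auto simp: bounded_iff)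
  have "cmod (g x) \<le> max K 0" for x
    using K[of x] assms(3)[of x] by (cases "x \<in> S") auto
  then show ?thesis by blast
qed

text \<open>
  All derivatives of \<open>f\<close> are continuous and vanish off its compact support, so they are
  bounded; \<open>K\<close> bounds the first and
  \<open>C\<close> the second derivative.
\<close>

lemma test_function_taylor:
  assumes "test_function f"
  obtains f' K C where "continuous_on UNIV f" "\<And>t. cmod (f' t) \<le> K"
    "\<And>s t. cmod (f s - f t - of_real (s - t) * f' t) \<le> C * (s - t)\<^sup>2"
proof -
  define S where "S = closure {x. f x \<noteq> 0}"
  define f1 where "f1 = nth_derivative 1 f"
  define f2 where "f2 = nth_derivative 2 f"
  have S: "compact S" using assms by (simp add: test_function_def S_def)
  then have U: "open (- S)" by (simp add: compact_imp_closed open_Compl)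
  have diff: "nth_derivative k f differentiable (at x)" for k x
    using assms by (simp add: test_function_def)
  have f0: "nth_derivative 0 f = f" by (simp add: nth_derivative_def)
  have step: "nth_derivative (Suc k) f x = vector_derivative (nth_derivative k f) (at x)" for k x
    by (simp add: nth_derivative_def)
  have z0: "f x = 0" if "x \<in> - S" for x
    using that closure_subset[of "{x. f x \<noteq> 0}"] by (auto simp: S_def)
  have z: "nth_derivative k f x = 0" if "x \<in> - S" for k x
    using that
  proof (induction k arbitrary: x)
    case 0
    then show ?case by (simp add: f0 z0)
  next
    case (Suc k)
    show ?case
      unfolding step by (rule vector_derivative_zero_open[OF U Suc.IH Suc.prems])
  qed
  have cont: "continuous_on UNIV (nth_derivative k f)" for k
    using diff by (intro differentiable_imp_continuous_on) (simp add: differentiable_on_def)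
  have deriv: "(nth_derivative k f has_vector_derivative nth_derivative (Suc k) f x) (at x)" for k x
    unfolding step using diff vector_derivative_works by blast
  have bd: "\<exists>K. \<forall>x. cmod (nth_derivative k f x) \<le> K" for k
    using z by (intro continuous_compact_support_bounded[OF S cont]) auto
  obtain K where K: "\<And>x. cmod (f1 x) \<le> K" using bd[of 1] by (auto simp: f1_def)
  obtain C where C: "\<And>x. cmod (f2 x) \<le> C" using bd[of 2] by (auto simp: f2_def)
  have d1: "(f has_vector_derivative f1 x) (at x)" for x
    using deriv[of 0 x] by (simp add: f0 f1_def)
  have d2: "(f1 has_vector_derivative f2 x) (at x)" for x
    using deriv[of 1 x] by (simp add: f1_def f2_def numeral_2_eq_2)
  have lip: "cmod (f1 s - f1 t) \<le> C * \<bar>s - t\<bar>" for s t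
  proof -
    have "cmod (f1 s - f1 t) \<le> C * norm (s - t)"
    proof (rule differentiable_bound[of UNIV f1 "\<lambda>x h. h *\<^sub>R f2 x"])
      show "(f1 has_derivative (\<lambda>h. h *\<^sub>R f2 x)) (at x within UNIV)" for x
        using d2[of x] by (simp add: has_vector_derivative_def)
      show "onorm (\<lambda>h. h *\<^sub>R f2 x) \<le> C" for x
        using C[of x] by (intro onorm_le) (auto simp: mult.commute[of C] intro: mult_left_mono)
    qed auto
    then show ?thesis by simp
  qed
  have "cmod (f s - f t - of_real (s - t) * f1 t) \<le> C * (s - t)\<^sup>2" for s t
  proof -
    have C0: "0 \<le> C" using C[of 0] norm_ge_zero order_trans by blast
    have "norm (f s - f t - (s - t) *\<^sub>R f1 t) \<le> norm (s - t) * (C * \<bar>s - t\<bar>)"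
    proof (rule vector_differentiable_bound_linearization)
      show "(f has_vector_derivative f1 x) (at x within closed_segment t s)" for x
        using d1 by (rule has_vector_derivative_at_within)
      show "norm (f1 x - f1 t) \<le> C * \<bar>s - t\<bar>" if "x \<in> closed_segment t s" for x
      proof -
        have "\<bar>x - t\<bar> \<le> \<bar>s - t\<bar>"
          using that by (auto simp: closed_segment_eq_real_ivl split: if_splits)
        then have "C * \<bar>x - t\<bar> \<le> C * \<bar>s - t\<bar>" using C0 by (rule mult_left_mono)
        then show ?thesis using lip[of x t] by linarith
      qed
    qed auto
    then show ?thesis by (simp add: scaleR_conv_of_real power2_eq_square mult_ac)
  qed
  then show ?thesis using that[of f1 K C] K cont[of 0] by (simp add: f0)
qed

text \<open>
  The deterministic estimate: \<open>\<Sum> |V n|\<close> is the trace norm of the restricted potential, the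
  factor \<open>L + 1\<close> is the energy rescaling, the denominator the normalisation of the measures.
\<close>

lemma local_measure_difference:
  assumes "test_function f"
  shows "\<exists>K. \<forall>L (V :: int ^ 'd \<Rightarrow> real).
    cmod (integral\<^sup>L (local_measure L E (schroedinger_op V)) f
        - integral\<^sup>L (local_measure L E (lattice_laplacian :: (int ^ 'd \<Rightarrow> complex) \<Rightarrow> _)) f)
    \<le> K * ((real L + 1) / (2 * real L + 1) ^ (CARD('d) - 1) * (\<Sum>n\<in>lattice_box L. \<bar>V n\<bar>))"
proof -
  obtain f' K C where f: "continuous_on UNIV f" and K: "\<And>t. cmod (f' t) \<le> K"
    and C: "\<And>s t. cmod (f s - f t - of_real (s - t) * f' t) \<le> C * (s - t)\<^sup>2"
    using test_function_taylor[OF assms] by blast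
  have meas: "f \<in> borel_measurable borel" using f by (rule borel_measurable_continuous_onI)
  have "cmod (integral\<^sup>L (local_measure L E (schroedinger_op V)) f
        - integral\<^sup>L (local_measure L E (lattice_laplacian :: (int ^ 'd \<Rightarrow> complex) \<Rightarrow> _)) f)
    \<le> K * ((real L + 1) / (2 * real L + 1) ^ (CARD('d) - 1) * (\<Sum>n\<in>lattice_box L. \<bar>V n\<bar>))"
    for L and V :: "int ^ 'd \<Rightarrow> real"
  proof -
    let ?\<Lambda> = "lattice_box L :: (int ^ 'd) set"
    define c where "c = (2 * real L + 1) ^ (CARD('d) - 1)"
    have c: "c > 0" by (simp add: c_def)
    note B = selfadjoint_on_scaled_schroedinger[of L E V]
    note A = selfadjoint_on_scaled_schroedinger[of L E "\<lambda>_ :: int ^ 'd. 0", unfolded schroedinger_op_zero]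
    obtain e l where e: "eigenfamily ?\<Lambda> (scaled_box_op L E lattice_laplacian) (card ?\<Lambda>) e l"
      using selfadjoint_on.eigenbasis_exists[OF A] by blast
    obtain g m where g: "eigenfamily ?\<Lambda> (scaled_box_op L E (schroedinger_op V)) (card ?\<Lambda>) g m"
      using selfadjoint_on.eigenbasis_exists[OF B] by blast
    have "cmod ((\<Sum>i<card ?\<Lambda>. f (m i)) - (\<Sum>i<card ?\<Lambda>. f (l i)))
        \<le> K * (\<Sum>n\<in>?\<Lambda>. \<bar>(real L + 1) * V n\<bar>)"
      by (rule trace_lipschitz[OF A B scaled_schroedinger_perturbation e g K C])
    also have "\<dots> = K * ((real L + 1) * (\<Sum>n\<in>?\<Lambda>. \<bar>V n\<bar>))"
      by (simp add: abs_mult sum_distrib_left)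
    finally have "cmod ((\<Sum>i<card ?\<Lambda>. f (m i)) - (\<Sum>i<card ?\<Lambda>. f (l i))) / c
        \<le> K * ((real L + 1) * (\<Sum>n\<in>?\<Lambda>. \<bar>V n\<bar>)) / c"
      using c by (simp add: divide_right_mono)
    then show ?thesis
      using c unfolding integral_local_measure[OF A e meas] integral_local_measure[OF B g meas]
        c_def[symmetric] diff_divide_distrib[symmetric] norm_divide
      by (simp add: mult_ac)
  qed
  then show ?thesis by blast
qed

lemma distributional_limit_point_cong:
  assumes "\<And>f. test_function f \<Longrightarrow> (\<lambda>L. integral\<^sup>L (\<mu> L) f - integral\<^sup>L (\<mu>' L) f) \<longlonglongrightarrow> 0"
  shows "distributional_limit_point \<mu> \<Psi> \<longleftrightarrow> distributional_limit_point \<mu>' \<Psi>"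
proof -
  have "(\<lambda>k. integral\<^sup>L (\<mu> (r k)) f) \<longlonglongrightarrow> \<Psi> f \<longleftrightarrow> (\<lambda>k. integral\<^sup>L (\<mu>' (r k)) f) \<longlonglongrightarrow> \<Psi> f"
    if "strict_mono r" "test_function f" for r f
  proof (rule Lim_transform_eq)
    show "(\<lambda>k. integral\<^sup>L (\<mu> (r k)) f - integral\<^sup>L (\<mu>' (r k)) f) \<longlonglongrightarrow> 0"
      using LIMSEQ_subseq_LIMSEQ[OF assms[OF that(2)] that(1)] by (simp add: o_def)
  qed
  then show ?thesis unfolding distributional_limit_point_def by metis
qed

section \<open>Almost sure decay of the averaged potential\<close>

text \<open>
  The lattice points of maximum norm exactly \<open>k\<close>.
\<close>

definition lattice_shell :: "nat \<Rightarrow> (int ^ 'd) set" where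
  "lattice_shell k = (case k of 0 \<Rightarrow> lattice_box 0 | Suc j \<Rightarrow> lattice_box (Suc j) - lattice_box j)"

lemma lattice_box_mono: "j \<le> k \<Longrightarrow> lattice_box j \<subseteq> lattice_box k"
  by (auto simp: lattice_box_def intro: order_trans)

lemma lattice_box_Suc: "lattice_box (Suc L) = lattice_box L \<union> lattice_shell (Suc L)"
  using lattice_box_mono[of L "Suc L"] by (auto simp: lattice_shell_def)

lemma finite_lattice_shell: "finite (lattice_shell k :: (int ^ 'd) set)"
  by (simp add: lattice_shell_def finite_lattice_box split: nat.split)

lemma sum_lattice_box_shells:
  fixes g :: "int ^ 'd \<Rightarrow> real"
  shows "(\<Sum>n\<in>lattice_box L. g n) = (\<Sum>k\<le>L. \<Sum>n\<in>lattice_shell k. g n)"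
proof (induction L)
  case 0
  then show ?case by (simp add: lattice_shell_def)
next
  case (Suc L)
  have "(\<Sum>n\<in>lattice_box (Suc L). g n) = (\<Sum>n\<in>lattice_box L. g n) + (\<Sum>n\<in>lattice_shell (Suc L). g n)"
    unfolding lattice_box_Suc
    by (rule sum.union_disjoint) (auto simp: finite_lattice_box finite_lattice_shell, auto simp: lattice_shell_def)
  then show ?case by (simp add: Suc)
qed

lemma lattice_shell_norm:
  assumes "n \<in> lattice_shell k"
  shows "real k \<le> lattice_norm n"
proof (cases k)
  case 0
  then show ?thesis by (simp add: lattice_norm_def)
next
  case (Suc j)
  then obtain i where "\<not> \<bar>n $ i\<bar> \<le> int j"
    using assms by (auto simp: lattice_shell_def lattice_box_def)
  then have "int k \<le> \<bar>n $ i\<bar>" using Suc by simp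
  then have "real k \<le> \<bar>real_of_int (n $ i)\<bar>" by linarith
  then show ?thesis using lattice_norm_component[of n i] by linarith
qed

text \<open>
  For \<open>k \<ge> 1\<close> the count is \<open>x\<^sup>d - (x - 2)\<^sup>d\<close> with \<open>x = 2 k + 1\<close>, and Bernoulli's inequality for
  \<open>(1 - 2 / x)\<^sup>d\<close> gains the power of \<open>x\<close>.
\<close>

lemma card_lattice_shell:
  "real (card (lattice_shell k :: (int ^ 'd) set)) \<le> 2 * real CARD('d) * (2 * real k + 1) ^ (CARD('d) - 1)"
proof (cases k)
  case 0
  have "0 < CARD('d)" by simp
  then have "1 \<le> 2 * real CARD('d)" by linarith
  then show ?thesis using 0 by (simp add: lattice_shell_def card_lattice_box)
next
  case (Suc j)
  define x where "x = 2 * real k + 1"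
  have x: "x \<ge> 3" "2 * real j + 1 = x - 2" using Suc by (auto simp: x_def)
  have sub: "lattice_box j \<subseteq> (lattice_box k :: (int ^ 'd) set)"
    using Suc by (intro lattice_box_mono) simp
  have shell: "lattice_shell k = lattice_box k - (lattice_box j :: (int ^ 'd) set)"
    using Suc by (simp add: lattice_shell_def)
  have "real (card (lattice_shell k :: (int ^ 'd) set))
      = real (card (lattice_box k :: (int ^ 'd) set)) - real (card (lattice_box j :: (int ^ 'd) set))"
    unfolding shell using sub
    by (simp add: card_Diff_subset finite_lattice_box card_mono of_nat_diff)
  also have "\<dots> = x ^ CARD('d) - (x - 2) ^ CARD('d)"
    unfolding card_lattice_box x(2)[symmetric] by (simp add: x_def add.commute)
  also have "\<dots> \<le> 2 * real CARD('d) * x ^ (CARD('d) - 1)"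
  proof -
    have xpow: "x ^ CARD('d) = x * x ^ (CARD('d) - 1)"
      by (metis power_eq_if zero_less_card_finite less_irrefl)
    have "1 + real CARD('d) * (- 2 / x) \<le> (1 + - 2 / x) ^ CARD('d)"
      by (rule Bernoulli_inequality) (use x in \<open>simp add: field_simps\<close>)
    then have "x ^ CARD('d) * (1 + real CARD('d) * (- 2 / x)) \<le> x ^ CARD('d) * (1 + - 2 / x) ^ CARD('d)"
      using x by (intro mult_left_mono) auto
    also have "\<dots> = (x - 2) ^ CARD('d)"
    proof -
      have "x * (1 + - 2 / x) = x - 2" using x by (simp add: field_simps)
      then show ?thesis by (simp only: power_mult_distrib[symmetric])
    qed
    also have "x ^ CARD('d) * (1 + real CARD('d) * (- 2 / x))
        = x ^ CARD('d) - 2 * real CARD('d) * x ^ (CARD('d) - 1)"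
      unfolding xpow using x by (simp add: field_simps)
    finally show ?thesis by simp
  qed
  finally show ?thesis by (simp add: x_def)
qed

text \<open>
  Kronecker's lemma for nonnegative terms: each summand \<open>((1 + k) / (1 + L))\<^sup>p b k\<close> tends to
  \<open>0\<close> and is dominated by \<open>b k\<close>.
\<close>

lemma kronecker_power:
  fixes b :: "nat \<Rightarrow> real"
  assumes b0: "\<And>k. 0 \<le> b k" and b: "summable b" and p: "p > 0"
  shows "(\<lambda>L. (\<Sum>k\<le>L. (1 + real k) ^ p * b k) / (1 + real L) ^ p) \<longlonglongrightarrow> 0"
proof -
  define c where "c = (\<lambda>k L. if k \<le> L then (1 + real k) ^ p * b k / (1 + real L) ^ p else 0)"
  have lim: "(\<lambda>L. c k L) \<longlonglongrightarrow> 0" for k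
  proof (rule Lim_transform_eventually)
    have "filterlim (\<lambda>L. (1 + real L) ^ p) at_top sequentially"
      using p by (intro filterlim_pow_at_top filterlim_tendsto_add_at_top[OF tendsto_const]
          filterlim_real_sequentially) auto
    then show "(\<lambda>L. (1 + real k) ^ p * b k / (1 + real L) ^ p) \<longlonglongrightarrow> 0"
      by (intro tendsto_divide_0[OF tendsto_const] filterlim_at_top_imp_at_infinity)
    show "\<forall>\<^sub>F L in sequentially. (1 + real k) ^ p * b k / (1 + real L) ^ p = c k L"
      using eventually_ge_at_top[of k] by eventually_elim (simp add: c_def)
  qed
  have bound: "norm (c k L) \<le> b k" for k L
  proof (cases "k \<le> L")
    case True
    have "(1 + real k) ^ p * b k \<le> (1 + real L) ^ p * b k"
      using True b0 by (intro mult_right_mono power_mono) auto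
    then show ?thesis using True b0[of k] by (simp add: c_def field_simps)
  next
    case False
    then show ?thesis using b0[of k] by (simp add: c_def)
  qed
  have "(\<lambda>L. suminf (\<lambda>k. c k L)) \<longlonglongrightarrow> suminf (\<lambda>_. 0)"
    using tannerys_theorem[OF lim always_eventually b] bound by simp
  moreover have "suminf (\<lambda>k. c k L) = (\<Sum>k\<le>L. (1 + real k) ^ p * b k) / (1 + real L) ^ p" for L
  proof -
    have "suminf (\<lambda>k. c k L) = (\<Sum>k\<le>L. c k L)"
      by (rule suminf_finite) (auto simp: c_def)
    then show ?thesis by (simp add: c_def sum_divide_distrib)
  qed
  ultimately show ?thesis by simp
qed

text \<open>
  A shell has about \<open>k\<^sup>d\<^sup>-\<^sup>1\<close> points carrying weights of size \<open>k\<^sup>-\<^sup>2\<^sup>-\<^sup>\<epsilon>\<close>, so division by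
  \<open>k\<^sup>d\<^sup>-\<^sup>2\<close> leaves the summable \<open>k\<^sup>-\<^sup>1\<^sup>-\<^sup>\<epsilon>\<close>.
\<close>

lemma shell_weight_bound:
  fixes a :: "int ^ 'd \<Rightarrow> real"
  assumes dim: "CARD('d) \<ge> 2" and \<epsilon>: "\<epsilon> > 0"
    and C: "\<And>n. a n * (1 + lattice_norm n) powr (2 + \<epsilon>) \<le> C" and a: "\<And>n. a n > 0"
  shows "(\<Sum>n\<in>lattice_shell k. a n) / (1 + real k) ^ (CARD('d) - 2)
    \<le> 2 ^ CARD('d) * real CARD('d) * C * (1 + real k) powr - (1 + \<epsilon>)"
proof -
  define y where "y = 1 + real k"
  define d where "d = CARD('d)"
  have y: "y \<ge> 1" by (simp add: y_def)
  have C0: "0 \<le> C"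
  proof -
    have "0 \<le> a 0 * (1 + lattice_norm (0 :: int ^ 'd)) powr (2 + \<epsilon>)" using a[of 0] by simp
    then show ?thesis using C[of 0] by linarith
  qed
  have an: "a n \<le> C * y powr - (2 + \<epsilon>)" if n: "n \<in> lattice_shell k" for n
  proof -
    have "a n * y powr (2 + \<epsilon>) \<le> a n * (1 + lattice_norm n) powr (2 + \<epsilon>)"
      using a[of n] lattice_shell_norm[OF n] \<epsilon> by (intro mult_left_mono powr_mono2) (auto simp: y_def)
    also note C[of n]
    finally have "a n \<le> C / y powr (2 + \<epsilon>)" using y by (simp add: pos_le_divide_eq)
    then show ?thesis by (simp only: powr_minus_divide times_divide_eq_right mult_1_right)
  qed
  have "(\<Sum>n\<in>lattice_shell k. a n) \<le> real (card (lattice_shell k :: (int ^ 'd) set)) * (C * y powr - (2 + \<epsilon>))"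
    using an by (rule sum_bounded_above)
  also have "\<dots> \<le> (2 * real d * (2 * real k + 1) ^ (d - 1)) * (C * y powr - (2 + \<epsilon>))"
    using card_lattice_shell[where 'd = 'd, of k] C0 by (intro mult_right_mono) (auto simp: d_def)
  also have "\<dots> \<le> (2 * real d * (2 * y) ^ (d - 1)) * (C * y powr - (2 + \<epsilon>))"
    using C0 by (intro mult_right_mono mult_left_mono power_mono) (auto simp: y_def)
  also have "\<dots> = 2 ^ d * real d * C * (y powr - (1 + \<epsilon>)) * y ^ (d - 2)"
  proof -
    obtain r where r: "d = Suc (Suc r)" using dim unfolding d_def
      by (metis Suc_diff_le Suc_1 le_add_diff_inverse add_2_eq_Suc)
    have "y powr - (1 + \<epsilon>) = y * y powr - (2 + \<epsilon>)"
      using y powr_add[of y 1 "- (2 + \<epsilon>)"] by simp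
    then show ?thesis by (simp add: r power_mult_distrib)
  qed
  finally show ?thesis
    using y by (simp add: y_def[symmetric] d_def[symmetric] pos_divide_le_eq)
qed

text \<open>
  Put \<open>p = d - 2 > 0\<close>. The series over shells with terms \<open>b k = (\<Sum> |a n q n|) / (1 + k)\<^sup>p\<close> has
  finite expectation, so it converges almost surely, and Kronecker's lemma converts this into
  \<open>(\<Sum> |a n q n|) / (1 + L)\<^sup>p \<rightarrow> 0\<close> for the sums over boxes. The prefactor
  \<open>(L + 1) / (2 L + 1)\<^sup>d\<^sup>-\<^sup>1\<close> is at most \<open>(1 + L)\<^sup>-\<^sup>p\<close>.
\<close>

lemma AE_potential_sum_negligible:
  fixes a :: "int ^ 'd \<Rightarrow> real" and q :: "int ^ 'd \<Rightarrow> 'w \<Rightarrow> real"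
  assumes dim: "CARD('d) \<ge> 3"
    and meas: "\<And>n. q n \<in> borel_measurable M"
    and mean: "\<And>n. (\<integral>\<^sup>+ \<omega>. ennreal \<bar>q n \<omega>\<bar> \<partial>M) = m" "m < \<infinity>"
    and a_pos: "\<And>n. a n > 0"
    and a_decay: "\<exists>\<epsilon>>0. bounded (range (\<lambda>n. a n * (1 + lattice_norm n) powr (2 + \<epsilon>)))"
  shows "AE \<omega> in M. (\<lambda>L. (real L + 1) / (2 * real L + 1) ^ (CARD('d) - 1)
      * (\<Sum>n\<in>lattice_box L. \<bar>a n * q n \<omega>\<bar>)) \<longlonglongrightarrow> 0"
proof -
  define p where "p = CARD('d) - 2"
  have p: "p > 0" using dim by (simp add: p_def)
  obtain \<epsilon> C where \<epsilon>: "\<epsilon> > 0" and C: "\<And>n. a n * (1 + lattice_norm n) powr (2 + \<epsilon>) \<le> C"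
  proof -
    obtain \<epsilon> where "\<epsilon> > 0" and bd: "bounded (range (\<lambda>n. a n * (1 + lattice_norm n) powr (2 + \<epsilon>)))"
      using a_decay by blast
    moreover from bd obtain C where "\<And>n. \<bar>a n * (1 + lattice_norm n) powr (2 + \<epsilon>)\<bar> \<le> C"
      unfolding bounded_iff real_norm_def by blast
    ultimately show ?thesis using that[of \<epsilon> C] abs_le_D1 by blast
  qed
  define b where "b = (\<lambda>\<omega> k. (\<Sum>n\<in>lattice_shell k. \<bar>a n * q n \<omega>\<bar>) / (1 + real k) ^ p)"
  have b0: "0 \<le> b \<omega> k" for \<omega> k by (simp add: b_def sum_nonneg)
  have bm: "(\<lambda>\<omega>. b \<omega> k) \<in> borel_measurable M" for k
    unfolding b_def using meas by measurable
  define c where "c = (\<lambda>k. 2 ^ CARD('d) * real CARD('d) * C * (1 + real k) powr - (1 + \<epsilon>))"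
  have Ak: "(\<Sum>n\<in>lattice_shell k. a n) / (1 + real k) ^ p \<le> c k" for k
    using shell_weight_bound[OF _ \<epsilon> C a_pos, of k] dim by (simp add: c_def p_def)
  have Ak0: "0 \<le> (\<Sum>n\<in>lattice_shell k. a n) / (1 + real k) ^ p" for k
    by (intro divide_nonneg_nonneg sum_nonneg) (auto intro: less_imp_le a_pos)
  have c0: "0 \<le> c k" for k using Ak[of k] Ak0[of k] by linarith
  have "summable (\<lambda>k. real (Suc k) powr - (1 + \<epsilon>))"
    using \<epsilon> by (subst summable_Suc_iff) (simp add: summable_real_powr_iff)
  then have csum: "summable c" unfolding c_def by (intro summable_mult) simp
  have Eb: "(\<integral>\<^sup>+ \<omega>. ennreal (b \<omega> k) \<partial>M) \<le> ennreal (c k) * m" for k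
  proof -
    have "(\<integral>\<^sup>+ \<omega>. ennreal (b \<omega> k) \<partial>M)
        = (\<integral>\<^sup>+ \<omega>. (\<Sum>n\<in>lattice_shell k. ennreal (a n / (1 + real k) ^ p) * ennreal \<bar>q n \<omega>\<bar>) \<partial>M)"
    proof (rule nn_integral_cong)
      fix \<omega>
      have "b \<omega> k = (\<Sum>n\<in>lattice_shell k. a n / (1 + real k) ^ p * \<bar>q n \<omega>\<bar>)"
        using a_pos by (simp add: b_def sum_divide_distrib abs_mult less_imp_le)
      also have "ennreal \<dots> = (\<Sum>n\<in>lattice_shell k. ennreal (a n / (1 + real k) ^ p * \<bar>q n \<omega>\<bar>))"
        using a_pos by (intro sum_ennreal[symmetric]) (simp add: less_imp_le)
      also have "\<dots> = (\<Sum>n\<in>lattice_shell k. ennreal (a n / (1 + real k) ^ p) * ennreal \<bar>q n \<omega>\<bar>)"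
        using a_pos by (intro sum.cong refl ennreal_mult) (simp_all add: less_imp_le)
      finally show "ennreal (b \<omega> k)
          = (\<Sum>n\<in>lattice_shell k. ennreal (a n / (1 + real k) ^ p) * ennreal \<bar>q n \<omega>\<bar>)" .
    qed
    also have "\<dots> = (\<Sum>n\<in>lattice_shell k. \<integral>\<^sup>+ \<omega>. ennreal (a n / (1 + real k) ^ p) * ennreal \<bar>q n \<omega>\<bar> \<partial>M)"
      using meas by (intro nn_integral_sum) measurable
    also have "\<dots> = (\<Sum>n\<in>lattice_shell k. ennreal (a n / (1 + real k) ^ p) * m)"
      using meas by (intro sum.cong refl) (subst nn_integral_cmult, auto simp: mean)
    also have "\<dots> = ennreal (\<Sum>n\<in>lattice_shell k. a n / (1 + real k) ^ p) * m"
      unfolding sum_distrib_right[symmetric] using a_pos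
      by (subst sum_ennreal) (auto simp: less_imp_le)
    also have "\<dots> \<le> ennreal (c k) * m"
      using Ak[of k] by (intro mult_right_mono ennreal_leI) (simp_all add: sum_divide_distrib)
    finally show ?thesis .
  qed
  have "(\<integral>\<^sup>+ \<omega>. (\<Sum>k. ennreal (b \<omega> k)) \<partial>M) = (\<Sum>k. \<integral>\<^sup>+ \<omega>. ennreal (b \<omega> k) \<partial>M)"
    using bm by (intro nn_integral_suminf) measurable
  also have "\<dots> \<le> (\<Sum>k. ennreal (c k) * m)"
    by (intro suminf_le Eb) auto
  also have "\<dots> = (\<Sum>k. ennreal (c k)) * m" by simp
  also have "\<dots> < \<infinity>"
    using mean(2) c0 by (simp add: suminf_ennreal2[OF c0 csum] ennreal_mult_less_top)
  finally have "AE \<omega> in M. (\<Sum>k. ennreal (b \<omega> k)) \<noteq> \<infinity>"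
    using bm by (intro nn_integral_noteq_infinite) auto
  then show ?thesis
  proof eventually_elim
    case (elim \<omega>)
    have "summable (b \<omega>)"
      using elim b0 by (intro summable_suminf_not_top) auto
    from kronecker_power[OF b0 this p]
    have lim: "(\<lambda>L. (\<Sum>n\<in>lattice_box L. \<bar>a n * q n \<omega>\<bar>) / (1 + real L) ^ p) \<longlonglongrightarrow> 0"
      by (simp add: sum_lattice_box_shells b_def)
    show ?case
    proof (rule tendsto_sandwich[OF _ _ tendsto_const lim]; intro always_eventually allI)
      fix L
      define S where "S = (\<Sum>n\<in>lattice_box L. \<bar>a n * q n \<omega>\<bar>)"
      have S0: "S \<ge> 0" by (simp add: S_def sum_nonneg)
      show "0 \<le> (real L + 1) / (2 * real L + 1) ^ (CARD('d) - 1) * S"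
        using S0 by simp
      have "CARD('d) - 1 = Suc p" using dim by (simp add: p_def)
      then have "(real L + 1) / (2 * real L + 1) ^ (CARD('d) - 1) \<le> (real L + 1) / (real L + 1) ^ Suc p"
        by (intro divide_left_mono) (auto intro!: power_mono mult_pos_pos zero_less_power simp del: power_Suc)
      also have "\<dots> = 1 / (1 + real L) ^ p" by (simp add: add.commute)
      finally show "(real L + 1) / (2 * real L + 1) ^ (CARD('d) - 1) * S \<le> S / (1 + real L) ^ p"
        using mult_right_mono[OF _ S0] by fastforce
    qed
  qed
qed

section \<open>Equality of the limit points\<close>

theorem theorem2p2:
  fixes E :: real
    and \<nu> :: "real measure"
    and M :: "'w measure"
    and q :: "int ^ 'd \<Rightarrow> 'w \<Rightarrow> real"
    and a :: "int ^ 'd \<Rightarrow> real"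
  assumes dim: "CARD('d) \<ge> 3"
    and E: "- 2 * real CARD('d) < E" "E < 2 * real CARD('d)"
    and nu: "prob_space \<nu>" "sets \<nu> = sets borel" "(\<integral>\<^sup>+ x. ennreal \<bar>x\<bar> \<partial>\<nu>) < \<infinity>"
    and M: "prob_space M"
    and indep: "prob_space.indep_vars M (\<lambda>_. borel) q UNIV"
    and distr: "\<And>n. distr M borel (q n) = \<nu>"
    and a_pos: "\<And>n. a n > 0"
    and a_decay: "\<exists>\<epsilon>>0. bounded (range (\<lambda>n. a n * (1 + lattice_norm n) powr (2 + \<epsilon>)))"
  shows "AE \<omega> in M.
    {\<Psi>. distributional_limit_point
          (\<lambda>L. local_measure L E (schroedinger_op (\<lambda>n. a n * q n \<omega>))) \<Psi>} =
    {\<Psi>. distributional_limit_point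
          (\<lambda>L. local_measure L E (lattice_laplacian :: (int ^ 'd \<Rightarrow> complex) \<Rightarrow> _)) \<Psi>}"
proof -
  interpret prob_space M by fact
  have meas: "q n \<in> borel_measurable M" for n
    using indep by (simp add: indep_vars_def)
  have mean: "(\<integral>\<^sup>+ \<omega>. ennreal \<bar>q n \<omega>\<bar> \<partial>M) = (\<integral>\<^sup>+ x. ennreal \<bar>x\<bar> \<partial>\<nu>)" for n
    unfolding distr[of n, symmetric] by (subst nn_integral_distr[OF meas]) auto
  have "AE \<omega> in M. (\<lambda>L. (real L + 1) / (2 * real L + 1) ^ (CARD('d) - 1)
      * (\<Sum>n\<in>lattice_box L. \<bar>a n * q n \<omega>\<bar>)) \<longlonglongrightarrow> 0"
    by (rule AE_potential_sum_negligible[OF dim meas mean nu(3) a_pos a_decay])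
  then show ?thesis
  proof eventually_elim
    case (elim \<omega>)
    have "(\<lambda>L. integral\<^sup>L (local_measure L E (schroedinger_op (\<lambda>n. a n * q n \<omega>))) f
        - integral\<^sup>L (local_measure L E (lattice_laplacian :: (int ^ 'd \<Rightarrow> complex) \<Rightarrow> _)) f) \<longlonglongrightarrow> 0"
      if f: "test_function f" for f
    proof -
      obtain K where K: "\<And>L (V :: int ^ 'd \<Rightarrow> real).
        cmod (integral\<^sup>L (local_measure L E (schroedinger_op V)) f
            - integral\<^sup>L (local_measure L E (lattice_laplacian :: (int ^ 'd \<Rightarrow> complex) \<Rightarrow> _)) f)
        \<le> K * ((real L + 1) / (2 * real L + 1) ^ (CARD('d) - 1) * (\<Sum>n\<in>lattice_box L. \<bar>V n\<bar>))"
        using local_measure_difference[OF f] by blast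
      show ?thesis
      proof (rule Lim_null_comparison)
        show "\<forall>\<^sub>F L in sequentially.
          cmod (integral\<^sup>L (local_measure L E (schroedinger_op (\<lambda>n. a n * q n \<omega>))) f
            - integral\<^sup>L (local_measure L E (lattice_laplacian :: (int ^ 'd \<Rightarrow> complex) \<Rightarrow> _)) f)
          \<le> K * ((real L + 1) / (2 * real L + 1) ^ (CARD('d) - 1)
              * (\<Sum>n\<in>lattice_box L. \<bar>a n * q n \<omega>\<bar>))"
          using K by (intro always_eventually allI)
        show "(\<lambda>L. K * ((real L + 1) / (2 * real L + 1) ^ (CARD('d) - 1)
              * (\<Sum>n\<in>lattice_box L. \<bar>a n * q n \<omega>\<bar>))) \<longlonglongrightarrow> 0"
          using tendsto_mult_right_zero[OF elim] .
      qed
    qed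
    then show ?case by (intro Collect_cong distributional_limit_point_cong)
  qed
qed

end
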